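(* Let $A,B\in\mathbb{C}^{2\times2}$ be regular boundary conditions such that $\Delta(A,B)$ generates a quasi-contractive $C_0$-semigroup on $L^2([0,\infty))\oplus L^2([0,\infty))$. Then the semigroup generated by $\Delta(A,B)$ is real if and only if $\mathfrak{S}(i\kappa;A,B)$ has real entries for all $\kappa>0$ for which $A-\kappa B$ is invertible. In this case, the semigroup is additionally positive whenever there is some $\kappa_0>0$ such that $I+\mathfrak{S}(i\kappa;A,B)$ leaves $\{\xi\in\mathbb{R}^2:\xi_1\ge0,\ \xi_2\ge0\}$ invariant for all $\kappa\ge\kappa_0$.
   Context: $I$ is the $2\times2$ identity matrix; $L^2([0,\infty))$ consists of complex-valued functions. Operator: for $A,B\in\mathbb{C}^{2\times2}$ with $\operatorname{Rank}(A\ B)=2$ (where $(A\ B)$ is the $2\times4$ block matrix), $\Delta(A,B)$ is the operator in $L^2([0,\infty))\oplus L^2([0,\infty))$ with domain the set of $\psi=(\psi_1,\psi_2)\in H^2([0,\infty))\oplus H^2([0,\infty))$ such that $A\,(\psi_1(0),\psi_2(0))^T+B\,(\psi_1'(0),\psi_2'(0))^T=0$, acting by $\Delta(A,B)\psi=(\psi_1'',\psi_2'')$. Regularity: boundary conditions $A,B$ with $\operatorname{Rank}(A\ B)=2$ are called regular if $A+ikB$ is invertible for some $k\in\mathbb{C}$. Cayley transform: $\mathfrak{S}(k;A,B):=-(A+ikB)^{-1}(A-ikB)$ for $k$ with $A+ikB$ invertible; thus $\mathfrak{S}(i\kappa;A,B)=-(A-\kappa B)^{-1}(A+\kappa B)$.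 A semigroup $(T(t))_{t\ge0}$ is quasi-contractive if $\|T(t)\|\le e^{\omega t}$ for all $t\ge0$ and some $\omega\in\mathbb{R}$; it is real if each $T(t)$ maps pairs of real-valued functions to pairs of real-valued functions; it is positive if each $T(t)$ maps pairs of a.e. nonnegative functions to pairs of a.e. nonnegative functions. *)

theory Defs
  imports "HOL-Analysis.Analysis"
begin

section \<open>The Hilbert space of square integrable functions on the half line\<close>

abbreviation half_line :: "real measure"
  where "half_line \<equiv> restrict_space lborel {0..}"

definition sq_integrable :: "(real \<Rightarrow> complex) \<Rightarrow> bool"
  where "sq_integrable f \<longleftrightarrow>
    f \<in> borel_measurable half_line \<and> integrable half_line (\<lambda>x. (norm (f x))\<^sup>2)"

lemma sq_integrable_zero: "sq_integrable (\<lambda>x. 0)"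
  by (simp add: sq_integrable_def)

lemma sq_integrable_mult: "sq_integrable (\<lambda>x. c * f x)" if "sq_integrable f"
  using that unfolding sq_integrable_def by (auto simp: norm_mult power_mult_distrib)

lemma sq_integrable_scaleR: "sq_integrable (\<lambda>x. r *\<^sub>R f x)" if "sq_integrable f"
  using sq_integrable_mult[OF that, of "of_real r"] by (simp add: scaleR_conv_of_real)

lemma sq_integrable_uminus: "sq_integrable (\<lambda>x. - f x)" if "sq_integrable f"
  using sq_integrable_mult[OF that, of "-1"] by simp

lemma sq_integrable_add: "sq_integrable (\<lambda>x. f x + g x)"
  if "sq_integrable f" "sq_integrable g"
proof -
  have meas: "f \<in> borel_measurable half_line" "g \<in> borel_measurable half_line"
    using that by (auto simp: sq_integrable_def)
  have "integrable half_line (\<lambda>x. (norm (f x + g x))\<^sup>2)"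
  proof (rule Bochner_Integration.integrable_bound)
    show "integrable half_line (\<lambda>x. 2 * (norm (f x))\<^sup>2 + 2 * (norm (g x))\<^sup>2)"
      using that by (auto simp: sq_integrable_def)
    have "(norm (a + b))\<^sup>2 \<le> 2 * (norm a)\<^sup>2 + 2 * (norm b)\<^sup>2" for a b :: complex
    proof -
      have "(norm (a + b))\<^sup>2 \<le> (norm a + norm b)\<^sup>2"
        by (intro power_mono norm_triangle_ineq norm_ge_zero)
      also have "\<dots> \<le> 2 * (norm a)\<^sup>2 + 2 * (norm b)\<^sup>2"
        using sum_squares_bound[of "norm a" "norm b"] by (simp add: power2_sum)
      finally show ?thesis .
    qed
    then show "AE x in half_line. norm ((norm (f x + g x))\<^sup>2)
        \<le> norm (2 * (norm (f x))\<^sup>2 + 2 * (norm (g x))\<^sup>2)"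
      by simp
  qed (use meas in measurable)
  then show ?thesis
    using meas by (simp add: sq_integrable_def)
qed

lemma sq_integrable_diff: "sq_integrable (\<lambda>x. f x - g x)"
  if "sq_integrable f" "sq_integrable g"
  using sq_integrable_add[OF that(1) sq_integrable_uminus[OF that(2)]] by simp

lemma sq_integrable_inner: "integrable half_line (\<lambda>x. f x \<bullet> g x)"
  if "sq_integrable f" "sq_integrable g"
proof (rule Bochner_Integration.integrable_bound)
  show "integrable half_line (\<lambda>x. (norm (f x))\<^sup>2 + (norm (g x))\<^sup>2)"
    using that by (auto simp: sq_integrable_def)
  show "(\<lambda>x. f x \<bullet> g x) \<in> borel_measurable half_line"
    using that by (auto simp: sq_integrable_def)
  have "\<bar>a \<bullet> b\<bar> \<le> (norm a)\<^sup>2 + (norm b)\<^sup>2" for a b :: complex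
  proof -
    have "\<bar>a \<bullet> b\<bar> \<le> norm a * norm b"
      by (rule Cauchy_Schwarz_ineq2)
    also have "\<dots> \<le> (norm a)\<^sup>2 + (norm b)\<^sup>2"
      using sum_squares_bound[of "norm a" "norm b"]
        mult_nonneg_nonneg[OF norm_ge_zero[of a] norm_ge_zero[of b]] by linarith
    finally show ?thesis .
  qed
  then show "AE x in half_line. norm (f x \<bullet> g x)
      \<le> norm ((norm (f x))\<^sup>2 + (norm (g x))\<^sup>2)"
    by simp
qed

definition ae_eq :: "(real \<Rightarrow> complex) \<Rightarrow> (real \<Rightarrow> complex) \<Rightarrow> bool"
  where "ae_eq f g \<longleftrightarrow>
    sq_integrable f \<and> sq_integrable g \<and> (AE x in half_line. f x = g x)"

text \<open>Every Lebesgue measurable function agrees almost everywhere with a Borel measurable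
  one, so Borel measurable representatives give the usual space.\<close>

quotient_type L2h = "real \<Rightarrow> complex" / partial: ae_eq
proof (rule part_equivpI)
  show "\<exists>f. ae_eq f f"
    using sq_integrable_zero by (auto simp: ae_eq_def)
  show "symp ae_eq"
    by (auto simp: symp_def ae_eq_def elim: eventually_mono)
  show "transp ae_eq"
    unfolding transp_def ae_eq_def
  proof (intro allI impI conjI; elim conjE)
    fix f g h
    assume "AE x in half_line. f x = g x" "AE x in half_line. g x = h x"
    then show "AE x in half_line. f x = h x" by eventually_elim simp
  qed
qed

text \<open>The real inner product is the real part of the Hermitian one; it induces the usual norm
  \<open>norm f = sqrt (\<integral> |f|\<^sup>2)\<close>. The library's product instance then makes
  \<open>L2h \<times> L2h\<close> the orthogonal direct sum.\<close>

instantiation L2h :: real_inner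
begin

lift_definition zero_L2h :: L2h is "\<lambda>x. 0"
  by (simp add: ae_eq_def sq_integrable_zero)

lift_definition plus_L2h :: "L2h \<Rightarrow> L2h \<Rightarrow> L2h" is "\<lambda>f g x. f x + g x"
  unfolding ae_eq_def by (auto intro: sq_integrable_add elim: eventually_elim2)

lift_definition uminus_L2h :: "L2h \<Rightarrow> L2h" is "\<lambda>f x. - f x"
  unfolding ae_eq_def by (auto intro: sq_integrable_uminus)

lift_definition minus_L2h :: "L2h \<Rightarrow> L2h \<Rightarrow> L2h" is "\<lambda>f g x. f x - g x"
  unfolding ae_eq_def by (auto intro: sq_integrable_diff elim: eventually_elim2)

lift_definition scaleR_L2h :: "real \<Rightarrow> L2h \<Rightarrow> L2h" is "\<lambda>r f x. r *\<^sub>R f x"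
  unfolding ae_eq_def by (auto intro: sq_integrable_scaleR elim: eventually_mono)

lift_definition inner_L2h :: "L2h \<Rightarrow> L2h \<Rightarrow> real"
  is "\<lambda>f g. LINT x|half_line. f x \<bullet> g x"
proof -
  fix f f' g g' assume ff: "ae_eq f f'" and gg: "ae_eq g g'"
  show "(LINT x|half_line. f x \<bullet> g x) = (LINT x|half_line. f' x \<bullet> g' x)"
  proof (rule integral_cong_AE)
    have "AE x in half_line. f x = f' x" "AE x in half_line. g x = g' x"
      using ff gg by (simp_all add: ae_eq_def)
    then show "AE x in half_line. f x \<bullet> g x = f' x \<bullet> g' x"
      by eventually_elim simp
  qed (use ff gg in \<open>auto simp: ae_eq_def sq_integrable_def\<close>)
qed

definition norm_L2h :: "L2h \<Rightarrow> real"
  where "norm_L2h f = sqrt (f \<bullet> f)"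

definition dist_L2h :: "L2h \<Rightarrow> L2h \<Rightarrow> real"
  where "dist_L2h f g = norm (f - g)"

definition sgn_L2h :: "L2h \<Rightarrow> L2h"
  where "sgn_L2h f = inverse (norm f) *\<^sub>R f"

definition uniformity_L2h :: "(L2h \<times> L2h) filter"
  where "uniformity_L2h = (INF e\<in>{0<..}. principal {(x, y). dist x y < e})"

definition open_L2h :: "L2h set \<Rightarrow> bool"
  where "open_L2h U \<longleftrightarrow> (\<forall>x\<in>U. \<forall>\<^sub>F (x', y) in uniformity. x' = x \<longrightarrow> y \<in> U)"

instance
proof
  fix f g h :: L2h and r s :: real
  show "f + g + h = f + (g + h)" "f + g = g + f" "0 + f = f" "- f + f = 0" "f - g = f + - g"
    by (transfer, simp add: ae_eq_def add.assoc add.commute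
        sq_integrable_add sq_integrable_uminus sq_integrable_diff sq_integrable_zero)+
  show "r *\<^sub>R (f + g) = r *\<^sub>R f + r *\<^sub>R g" "(r + s) *\<^sub>R f = r *\<^sub>R f + s *\<^sub>R f"
    "r *\<^sub>R s *\<^sub>R f = (r * s) *\<^sub>R f" "1 *\<^sub>R f = f"
    by (transfer, simp add: ae_eq_def algebra_simps
        sq_integrable_add sq_integrable_scaleR)+
  show "f \<bullet> g = g \<bullet> f"
    by transfer (simp add: inner_commute)
  show "(f + g) \<bullet> h = f \<bullet> h + g \<bullet> h"
    by transfer (simp add: ae_eq_def inner_add_left sq_integrable_inner)
  show "(r *\<^sub>R f) \<bullet> g = r * (f \<bullet> g)"
    by transfer simp
  show "0 \<le> f \<bullet> f"
    by transfer simp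
  show "f \<bullet> f = 0 \<longleftrightarrow> f = 0"
  proof transfer
    fix u assume u: "ae_eq u u"
    then have "(LINT x|half_line. u x \<bullet> u x) = 0 \<longleftrightarrow> (AE x in half_line. u x \<bullet> u x = 0)"
      by (intro integral_nonneg_eq_0_iff_AE sq_integrable_inner) (auto simp: ae_eq_def)
    then show "(LINT x|half_line. u x \<bullet> u x) = 0 \<longleftrightarrow> ae_eq u (\<lambda>x. 0)"
      using u by (simp add: ae_eq_def sq_integrable_zero)
  qed
  show "norm f = sqrt (f \<bullet> f)" "dist f g = norm (f - g)" "sgn f = inverse (norm f) *\<^sub>R f"
    by (fact norm_L2h_def dist_L2h_def sgn_L2h_def)+
  show "uniformity = (INF e\<in>{0<..}. principal {(x, y :: L2h). dist x y < e})"
    by (fact uniformity_L2h_def)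
  show "open U \<longleftrightarrow> (\<forall>x\<in>U. \<forall>\<^sub>F (x', y) in uniformity. x' = x \<longrightarrow> y \<in> U)"
    for U :: "L2h set"
    by (fact open_L2h_def)
qed

end

lift_definition cscale :: "complex \<Rightarrow> L2h \<Rightarrow> L2h" is "\<lambda>c f x. c * f x"
  unfolding ae_eq_def by (auto intro: sq_integrable_mult elim: eventually_mono)

lift_definition real_valued :: "L2h \<Rightarrow> bool" is "\<lambda>f. AE x in half_line. f x \<in> \<real>"
proof -
  fix f g assume "ae_eq f g"
  then have "AE x in half_line. f x = g x" by (simp add: ae_eq_def)
  then have "AE x in half_line. (f x \<in> \<real>) = (g x \<in> \<real>)" by eventually_elim simp
  then show "(AE x in half_line. f x \<in> \<real>) = (AE x in half_line. g x \<in> \<real>)"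
    by (rule eventually_subst)
qed

lift_definition nonneg_valued :: "L2h \<Rightarrow> bool"
  is "\<lambda>f. AE x in half_line. f x \<in> \<real>\<^sub>\<ge>\<^sub>0"
proof -
  fix f g assume "ae_eq f g"
  then have "AE x in half_line. f x = g x" by (simp add: ae_eq_def)
  then have "AE x in half_line. (f x \<in> \<real>\<^sub>\<ge>\<^sub>0) = (g x \<in> \<real>\<^sub>\<ge>\<^sub>0)"
    by eventually_elim simp
  then show "(AE x in half_line. f x \<in> \<real>\<^sub>\<ge>\<^sub>0) = (AE x in half_line. g x \<in> \<real>\<^sub>\<ge>\<^sub>0)"
    by (rule eventually_subst)
qed

type_synonym state = "L2h \<times> L2h"


section \<open>Sobolev space of second order\<close>

text \<open>Following Brezis, weak derivatives on an interval are tested against continuously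
  differentiable functions with compact support in its interior; by mollification this is the
  same as testing against smooth ones.\<close>

definition test_function :: "(real \<Rightarrow> real) \<Rightarrow> bool"
  where "test_function \<phi> \<longleftrightarrow> \<phi> C1_differentiable_on UNIV
    \<and> compact (closure {x. \<phi> x \<noteq> 0}) \<and> closure {x. \<phi> x \<noteq> 0} \<subseteq> {0<..}"

lift_definition has_weak_deriv :: "L2h \<Rightarrow> L2h \<Rightarrow> bool"
  is "\<lambda>f g. \<forall>\<phi>. test_function \<phi> \<longrightarrow>
    (LINT x|half_line. deriv \<phi> x *\<^sub>R f x) = - (LINT x|half_line. \<phi> x *\<^sub>R g x)"
proof -
  fix f f' g g' assume ff: "ae_eq f f'" and gg: "ae_eq g g'"
  have "(LINT x|half_line. deriv \<phi> x *\<^sub>R f x) = (LINT x|half_line. deriv \<phi> x *\<^sub>R f' x)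
      \<and> (LINT x|half_line. \<phi> x *\<^sub>R g x) = (LINT x|half_line. \<phi> x *\<^sub>R g' x)"
    if "test_function \<phi>" for \<phi>
  proof -
    obtain D where D: "\<And>x. (\<phi> has_vector_derivative D x) (at x)" "continuous_on UNIV D"
      using \<open>test_function \<phi>\<close> by (auto simp: test_function_def C1_differentiable_on_def)
    have "deriv \<phi> = D"
      using D(1) by (auto intro!: DERIV_imp_deriv simp: has_real_derivative_iff_has_vector_derivative)
    moreover have "continuous_on UNIV \<phi>"
      using D(1) by (auto intro!: continuous_at_imp_continuous_on has_vector_derivative_continuous)
    ultimately have m: "deriv \<phi> \<in> borel_measurable half_line" "\<phi> \<in> borel_measurable half_line"
      using D(2) by (auto intro!: measurable_restrict_space1 borel_measurable_continuous_onI)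
    have "AE x in half_line. f x = f' x" "AE x in half_line. g x = g' x"
      using ff gg by (auto simp: ae_eq_def)
    moreover have "f \<in> borel_measurable half_line" "f' \<in> borel_measurable half_line"
      "g \<in> borel_measurable half_line" "g' \<in> borel_measurable half_line"
      using ff gg by (auto simp: ae_eq_def sq_integrable_def)
    ultimately show ?thesis
      using m by (auto intro!: integral_cong_AE elim: eventually_mono)
  qed
  then show "(\<forall>\<phi>. test_function \<phi> \<longrightarrow>
      (LINT x|half_line. deriv \<phi> x *\<^sub>R f x) = - (LINT x|half_line. \<phi> x *\<^sub>R g x)) =
    (\<forall>\<phi>. test_function \<phi> \<longrightarrow>
      (LINT x|half_line. deriv \<phi> x *\<^sub>R f' x) = - (LINT x|half_line. \<phi> x *\<^sub>R g' x))"
    by auto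
qed

definition weak_deriv :: "L2h \<Rightarrow> L2h"
  where "weak_deriv f = (THE g. has_weak_deriv f g)"

definition H2 :: "L2h set"
  where "H2 = {f. \<exists>g h. has_weak_deriv f g \<and> has_weak_deriv g h}"

text \<open>The value at the boundary point is that of the continuous representative; it is only
  meaningful for elements having one, in particular for \<open>f\<close> and \<open>weak_deriv f\<close>
  with \<open>f \<in> H2\<close>.\<close>

lift_definition at_zero :: "L2h \<Rightarrow> complex"
  is "\<lambda>f. THE c. \<exists>u. continuous_on {0..} u \<and> (AE x in half_line. u x = f x) \<and> u 0 = c"
proof -
  fix f g assume "ae_eq f g"
  then have fg: "AE x in half_line. f x = g x" by (simp add: ae_eq_def)
  have "(AE x in half_line. u x = f x) = (AE x in half_line. u x = g x)" for u :: "real \<Rightarrow> complex"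
    by (rule eventually_subst) (use fg in eventually_elim, simp)
  then show "(THE c. \<exists>u. continuous_on {0..} u \<and> (AE x in half_line. u x = f x) \<and> u 0 = c) =
    (THE c. \<exists>u. continuous_on {0..} u \<and> (AE x in half_line. u x = g x) \<and> u 0 = c)"
    by simp
qed


section \<open>Boundary conditions and the Laplacian\<close>

type_synonym cmat = "complex^2^2"

definition block_row :: "cmat \<Rightarrow> cmat \<Rightarrow> complex^(2 + 2)^2"
  where "block_row A B = (\<chi> i j. case j of Inl l \<Rightarrow> A $ i $ l | Inr l \<Rightarrow> B $ i $ l)"

definition bc_pencil :: "complex \<Rightarrow> cmat \<Rightarrow> cmat \<Rightarrow> cmat"
  where "bc_pencil k A B = A + map_matrix ((*) (\<i> * k)) B"

definition regular_bc :: "cmat \<Rightarrow> cmat \<Rightarrow> bool"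
  where "regular_bc A B \<longleftrightarrow>
    rank (block_row A B) = 2 \<and> (\<exists>k. invertible (bc_pencil k A B))"

definition cayley :: "complex \<Rightarrow> cmat \<Rightarrow> cmat \<Rightarrow> cmat"
  where "cayley k A B = - (matrix_inv (bc_pencil k A B) ** (A - map_matrix ((*) (\<i> * k)) B))"

definition laplacian_dom :: "cmat \<Rightarrow> cmat \<Rightarrow> state set"
  where "laplacian_dom A B = {(\<psi>1, \<psi>2). \<psi>1 \<in> H2 \<and> \<psi>2 \<in> H2 \<and>
    A *v vector [at_zero \<psi>1, at_zero \<psi>2]
      + B *v vector [at_zero (weak_deriv \<psi>1), at_zero (weak_deriv \<psi>2)] = 0}"

text \<open>Unbounded operators are given by their graphs.\<close>

definition laplacian :: "cmat \<Rightarrow> cmat \<Rightarrow> (state \<times> state) set"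
  where "laplacian A B = {((\<psi>1, \<psi>2), (weak_deriv (weak_deriv \<psi>1), weak_deriv (weak_deriv \<psi>2)))
    |\<psi>1 \<psi>2. (\<psi>1, \<psi>2) \<in> laplacian_dom A B}"


section \<open>Semigroups\<close>

text \<open>Only the values at nonnegative times matter. The library's bounded linear functions are
  real-linear, hence the separate requirement of complex homogeneity.\<close>

definition C0_semigroup :: "(real \<Rightarrow> state \<Rightarrow>\<^sub>L state) \<Rightarrow> bool"
  where "C0_semigroup T \<longleftrightarrow>
    (\<forall>t\<ge>0. \<forall>c \<psi>. T t (map_prod (cscale c) (cscale c) \<psi>)
                   = map_prod (cscale c) (cscale c) (T t \<psi>)) \<and>
    T 0 = id_blinfun \<and>
    (\<forall>s\<ge>0. \<forall>t\<ge>0. T (s + t) = T s o\<^sub>L T t) \<and>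
    (\<forall>\<psi>. ((\<lambda>t. T t \<psi>) \<longlongrightarrow> \<psi>) (at_right 0))"

definition generator :: "(real \<Rightarrow> state \<Rightarrow>\<^sub>L state) \<Rightarrow> (state \<times> state) set"
  where "generator T = {(\<psi>, \<eta>). ((\<lambda>h. (T h \<psi> - \<psi>) /\<^sub>R h) \<longlongrightarrow> \<eta>) (at_right 0)}"

definition quasi_contractive :: "(real \<Rightarrow> state \<Rightarrow>\<^sub>L state) \<Rightarrow> bool"
  where "quasi_contractive T \<longleftrightarrow> (\<exists>\<omega>. \<forall>t\<ge>0. norm (T t) \<le> exp (\<omega> * t))"

definition real_semigroup :: "(real \<Rightarrow> state \<Rightarrow>\<^sub>L state) \<Rightarrow> bool"
  where "real_semigroup T \<longleftrightarrow> (\<forall>t\<ge>0. \<forall>\<psi>. real_valued (fst \<psi>) \<and> real_valued (snd \<psi>)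
    \<longrightarrow> real_valued (fst (T t \<psi>)) \<and> real_valued (snd (T t \<psi>)))"

definition positive_semigroup :: "(real \<Rightarrow> state \<Rightarrow>\<^sub>L state) \<Rightarrow> bool"
  where "positive_semigroup T \<longleftrightarrow> (\<forall>t\<ge>0. \<forall>\<psi>. nonneg_valued (fst \<psi>) \<and> nonneg_valued (snd \<psi>)
    \<longrightarrow> nonneg_valued (fst (T t \<psi>)) \<and> nonneg_valued (snd (T t \<psi>)))"


section \<open>Real matrices and invariance of the nonnegative quadrant\<close>

definition real_entries :: "cmat \<Rightarrow> bool"
  where "real_entries M \<longleftrightarrow> (\<forall>i j. M $ i $ j \<in> \<real>)"

text \<open>The quadrant is regarded as a subset of \<open>complex^2\<close>.\<close>

definition leaves_quadrant_invariant :: "cmat \<Rightarrow> bool"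
  where "leaves_quadrant_invariant M \<longleftrightarrow>
    (\<forall>\<xi>. (\<forall>i. \<xi> $ i \<in> \<real>\<^sub>\<ge>\<^sub>0) \<longrightarrow> (\<forall>i. (M *v \<xi>) $ i \<in> \<real>\<^sub>\<ge>\<^sub>0))"

end

theory Submission
  imports Defs
begin

text \<open>Let \<open>S\<close> denote the Cayley transform at \<open>\<i> * \<kappa>\<close>. If \<open>\<kappa> > 0\<close> and \<open>A - \<kappa> * B\<close> is invertible, the pairs of
  boundary values \<open>(\<psi> 0, \<psi>' 0)\<close> allowed by \<open>A\<close> and \<open>B\<close> are exactly the pairs \<open>(v + S v, \<kappa> * (v - S v))\<close>
  (\<open>boundary_condition_iff_cayley\<close>). Both directions of the equivalence rest on this description.

  If the semigroup is real, it commutes with taking real parts, and so does its generator. The domain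
  contains explicit exponentials with arbitrary admissible boundary values, so real parts of admissible boundary
  values are admissible. For a real vector \<open>v\<close> this forces \<open>S v\<close> to equal its own real part
  (\<open>real_semigroup_cayley_real\<close>).

  The converse and the positivity statement are the same argument, carried out for a set \<open>C\<close> that is either the reals
  or the nonnegative reals. Compactly supported continuous data \<open>k\<close> with values in \<open>C\<close> admit an explicit solution of
  \<open>\<kappa>\<^sup>2 * w - w'' = \<kappa>\<^sup>2 * k\<close> in the domain, namely the Dirichlet solution, whose Green function is
  nonnegative, plus \<open>exp (- \<kappa> * x) * (g + S g)\<close> with a vector \<open>g\<close> whose entries lie in \<open>C\<close>. So the
  resolvent preserves \<open>C\<close> as soon as \<open>1 + S\<close> does (\<open>laplacian_resolvent\<close>).

  Invariance under the resolvents for all large \<open>\<kappa>\<close> passes to the semigroup by a comparison in time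
  (\<open>semigroup_invariant_if_resolvent_invariant\<close>). Quasi-contractivity makes the generator
  quasi-dissipative, and for \<open>u\<close> in its domain \<open>T h u\<close> solves the resolvent equation with right-hand side \<open>u\<close> up to
  \<open>o(h)\<close>. Hence the distance of an orbit to the closed set of states with values in \<open>C\<close> satisfies a differential inequality and remains
  zero if it starts at zero. What remains is the density of nice functions: bumps are dense in the whole
  space, whence the domain is dense and weak derivatives are unique (\<open>closure_bumps\<close>), and continuous functions
  with compact support and values in \<open>C\<close> are dense among the functions with values in \<open>C\<close>
  (\<open>values_in_subset_closure\<close>).\<close>

section \<open>Invariant sets of quasi-contractive semigroups\<close>

text \<open>For every positive \<open>e\<close> the set of times up to \<open>b\<close> at which \<open>F s \<le> F 0 + e * s\<close> is compact, and the
  slope condition lets one move a little to the right of its last element. One-sided slopes are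
  what the definition of the generator provides.\<close>

lemma le_initial_value_if_right_slope_nonpos:
  fixes F :: "real \<Rightarrow> real"
  assumes cont: "continuous_on {0..} F"
    and slope: "\<And>t e. 0 \<le> t \<Longrightarrow> 0 < e \<Longrightarrow> \<forall>\<^sub>F h in at_right 0. F (t + h) \<le> F t + e * h"
    and b: "0 \<le> b"
  shows "F b \<le> F 0"
proof (rule field_le_epsilon)
  fix d :: real assume d: "0 < d"
  define e where "e = d / (b + 1)"
  have e: "0 < e" "e * b \<le> d"
    using d b by (auto simp: e_def field_simps)
  define S where "S = {0..b} \<inter> (\<lambda>s. F s - e * s) -` {..F 0}"
  have "continuous_on {0..b} (\<lambda>s. F s - e * s)"
    by (intro continuous_intros continuous_on_subset[OF cont]) auto
  then have "closed S"
    unfolding S_def by (rule continuous_closed_preimage) auto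
  moreover have "bounded S"
    by (rule bounded_subset[of "{0..b}"]) (auto simp: S_def)
  ultimately have "compact S"
    by (simp add: compact_eq_bounded_closed)
  moreover have "0 \<in> S"
    using b by (auto simp: S_def)
  ultimately obtain c where c: "c \<in> S" "\<And>s. s \<in> S \<Longrightarrow> s \<le> c"
    using compact_attains_sup[of S] by blast
  have "c = b"
  proof (rule ccontr)
    assume "c \<noteq> b"
    then have "c < b" "0 \<le> c" using c by (auto simp: S_def)
    have "\<forall>\<^sub>F h in at_right 0. F (c + h) \<le> F c + e * h"
      by (rule slope) (use \<open>0 \<le> c\<close> e in auto)
    moreover have "\<forall>\<^sub>F h in at_right 0. h < b - c"
      using \<open>c < b\<close> by (intro eventually_at_rightI[of _ "b - c"]) auto
    moreover have "\<forall>\<^sub>F h in at_right (0::real). 0 < h"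
      by (simp add: eventually_at_right_less)
    ultimately have "\<forall>\<^sub>F h in at_right (0::real). 0 < h \<and> h < b - c \<and> F (c + h) \<le> F c + e * h"
      by eventually_elim simp
    then obtain h where h: "0 < h" "h < b - c" "F (c + h) \<le> F c + e * h"
      using eventually_happens'[of "at_right (0::real)"] trivial_limit_at_right_real by blast
    then have "c + h \<in> S"
      using c \<open>0 \<le> c\<close> by (auto simp: S_def algebra_simps)
    with c(2) h show False by force
  qed
  with c have "F b \<le> F 0 + e * b" by (auto simp: S_def)
  with e show "F b \<le> F 0 + d" by linarith
qed

lemma quasi_contractiveE:
  assumes "quasi_contractive T"
  obtains \<omega> where "0 \<le> \<omega>" "\<And>t. 0 \<le> t \<Longrightarrow> norm (T t) \<le> exp (\<omega> * t)"
proof -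
  from assms obtain \<omega> where \<omega>: "\<And>t. 0 \<le> t \<Longrightarrow> norm (T t) \<le> exp (\<omega> * t)"
    by (auto simp: quasi_contractive_def)
  have "norm (T t) \<le> exp (max \<omega> 0 * t)" if "0 \<le> t" for t
  proof -
    have "exp (\<omega> * t) \<le> exp (max \<omega> 0 * t)"
      using that by (auto intro!: mult_right_mono)
    with \<omega>[OF that] show ?thesis by linarith
  qed
  then show thesis by (intro that[of "max \<omega> 0"]) auto
qed

lemma C0_semigroup_add:
  assumes "C0_semigroup T" "0 \<le> s" "0 \<le> t"
  shows "T (s + t) \<psi> = T s (T t \<psi>)"
  using assms by (simp add: C0_semigroup_def)

lemma C0_semigroup_norm_le:
  assumes "\<And>t. 0 \<le> t \<Longrightarrow> norm (T t) \<le> exp (\<omega> * t)" "0 \<le> t"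
  shows "norm (blinfun_apply (T t) \<psi>) \<le> exp (\<omega> * t) * norm \<psi>"
  by (rule order_trans[OF norm_blinfun mult_right_mono[OF assms(1) norm_ge_zero]]) fact

lemma C0_semigroup_tendsto:
  assumes "C0_semigroup T"
  shows "((\<lambda>h. T h \<psi>) \<longlongrightarrow> \<psi>) (at_right 0)"
  using assms unfolding C0_semigroup_def by blast

text \<open>Continuity from the right at time zero spreads to all times because two values of an orbit differ
  by the image, under an operator of controlled norm, of a difference near time zero. Quasi-contractivity
  gives that control.\<close>

lemma C0_semigroup_continuous_orbit:
  assumes sg: "C0_semigroup T" and qc: "quasi_contractive T"
  shows "continuous_on {0..} (\<lambda>t. T t \<psi>)"
  unfolding continuous_on_def
proof
  fix t :: real assume "t \<in> {0..}"
  then have t: "0 \<le> t" by simp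
  obtain \<omega> where \<omega>: "0 \<le> \<omega>" "\<And>t. 0 \<le> t \<Longrightarrow> norm (T t) \<le> exp (\<omega> * t)"
    using quasi_contractiveE[OF qc] by blast
  have bound: "norm (T s \<psi> - T t \<psi>) \<le> exp (\<omega> * t) * norm (T \<bar>s - t\<bar> \<psi> - \<psi>)" if "0 \<le> s" for s
  proof -
    have *: "norm (T r (T d \<psi>) - T r \<psi>) \<le> exp (\<omega> * t) * norm (T d \<psi> - \<psi>)"
      if "0 \<le> r" "r \<le> t" for r d
    proof -
      have "norm (T r (T d \<psi>) - T r \<psi>) \<le> exp (\<omega> * r) * norm (T d \<psi> - \<psi>)"
        using C0_semigroup_norm_le[of T \<omega> r "T d \<psi> - \<psi>"] \<omega>(2) that by (simp add: blinfun.diff_right)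
      also have "\<dots> \<le> exp (\<omega> * t) * norm (T d \<psi> - \<psi>)"
        using that \<omega>(1) by (intro mult_right_mono) (auto intro: mult_left_mono)
      finally show ?thesis .
    qed
    show ?thesis
    proof (cases "s \<le> t")
      case True
      then show ?thesis
        using *[of s "t - s"] C0_semigroup_add[OF sg, of s "t - s" \<psi>] \<open>0 \<le> s\<close>
        by (simp add: norm_minus_commute)
    next
      case False
      then show ?thesis
        using *[of t "s - t"] C0_semigroup_add[OF sg, of t "s - t" \<psi>] t by simp
    qed
  qed
  have "((\<lambda>h. T h \<psi>) \<longlongrightarrow> \<psi>) (at_right 0)"
    by (rule C0_semigroup_tendsto[OF sg])
  moreover have "filterlim (\<lambda>s. \<bar>s - t\<bar>) (at_right 0) (at t within {0..})"
    unfolding filterlim_at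
    by (auto intro!: tendsto_eq_intros simp: eventually_at_filter)
  ultimately have "((\<lambda>s. T \<bar>s - t\<bar> \<psi>) \<longlongrightarrow> \<psi>) (at t within {0..})"
    by (rule filterlim_compose)
  then have "((\<lambda>s. exp (\<omega> * t) * norm (T \<bar>s - t\<bar> \<psi> - \<psi>)) \<longlongrightarrow> 0) (at t within {0..})"
    by (intro tendsto_mult_right_zero tendsto_norm_zero) (simp add: LIM_zero_iff)
  moreover have "\<forall>\<^sub>F s in at t within {0..}.
      norm (T s \<psi> - T t \<psi>) \<le> exp (\<omega> * t) * norm (T \<bar>s - t\<bar> \<psi> - \<psi>)"
    unfolding eventually_at_filter using bound by (intro always_eventually) auto
  ultimately have "((\<lambda>s. T s \<psi> - T t \<psi>) \<longlongrightarrow> 0) (at t within {0..})"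
    by (rule Lim_null_comparison[rotated])
  then show "((\<lambda>s. T s \<psi>) \<longlongrightarrow> T t \<psi>) (at t within {0..})"
    by (simp add: LIM_zero_iff)
qed

lemma generator_diff:
  assumes "(\<psi>, \<eta>) \<in> generator T" "(\<psi>', \<eta>') \<in> generator T"
  shows "(\<psi> - \<psi>', \<eta> - \<eta>') \<in> generator T"
proof -
  have "((\<lambda>h. (T h \<psi> - \<psi>) /\<^sub>R h - (T h \<psi>' - \<psi>') /\<^sub>R h) \<longlongrightarrow> \<eta> - \<eta>') (at_right 0)"
    using assms by (auto simp: generator_def intro!: tendsto_diff)
  then show ?thesis
    by (simp add: generator_def blinfun.diff_right algebra_simps)
qed

lemma generator_orbit:
  assumes sg: "C0_semigroup T" and "(\<psi>, \<eta>) \<in> generator T" "0 \<le> t"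
  shows "(T t \<psi>, T t \<eta>) \<in> generator T"
proof -
  have "((\<lambda>h. T t ((T h \<psi> - \<psi>) /\<^sub>R h)) \<longlongrightarrow> T t \<eta>) (at_right 0)"
    using assms by (intro blinfun.tendsto) (auto simp: generator_def)
  moreover have "\<forall>\<^sub>F h in at_right 0. T t ((T h \<psi> - \<psi>) /\<^sub>R h) = (T h (T t \<psi>) - T t \<psi>) /\<^sub>R h"
    using eventually_at_right_less[of 0]
  proof eventually_elim
    case (elim h)
    then show ?case
      using C0_semigroup_add[OF sg, of t h \<psi>] C0_semigroup_add[OF sg, of h t \<psi>] \<open>0 \<le> t\<close>
      by (simp add: blinfun.diff_right blinfun.scaleR_right add.commute)
  qed
  ultimately show ?thesis
    by (simp add: generator_def tendsto_cong)
qed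

text \<open>This is the derivative at time zero of the bound \<open>T h \<psi> \<bullet> \<psi> \<le> exp (\<omega> * h) * (norm \<psi>)\<^sup>2\<close>.\<close>

lemma generator_dissipative:
  assumes bound: "\<And>t. 0 \<le> t \<Longrightarrow> norm (T t) \<le> exp (\<omega> * t)"
    and gen: "(\<psi>, \<eta>) \<in> generator T"
  shows "\<eta> \<bullet> \<psi> \<le> \<omega> * (norm \<psi>)\<^sup>2"
proof (rule tendsto_le[of "at_right (0::real)"])
  have "((\<lambda>h. (T h \<psi> - \<psi>) /\<^sub>R h) \<longlongrightarrow> \<eta>) (at_right 0)"
    using gen by (simp add: generator_def)
  then show "((\<lambda>h. ((T h \<psi> - \<psi>) /\<^sub>R h) \<bullet> \<psi>) \<longlongrightarrow> \<eta> \<bullet> \<psi>) (at_right 0)"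
    by (rule tendsto_inner[OF _ tendsto_const])
  have "((\<lambda>h. exp (\<omega> * h)) has_real_derivative \<omega>) (at 0)"
    by (auto intro!: derivative_eq_intros)
  then have "((\<lambda>h. (exp (\<omega> * h) - 1) / h) \<longlongrightarrow> \<omega>) (at 0)"
    by (simp add: DERIV_def)
  then have "((\<lambda>h. (exp (\<omega> * h) - 1) / h) \<longlongrightarrow> \<omega>) (at_right 0)"
    by (rule tendsto_mono[rotated]) (simp add: at_le)
  then show "((\<lambda>h. (exp (\<omega> * h) - 1) / h * (norm \<psi>)\<^sup>2) \<longlongrightarrow> \<omega> * (norm \<psi>)\<^sup>2) (at_right 0)"
    by (intro tendsto_intros)
  show "\<forall>\<^sub>F h in at_right 0. ((T h \<psi> - \<psi>) /\<^sub>R h) \<bullet> \<psi> \<le> (exp (\<omega> * h) - 1) / h * (norm \<psi>)\<^sup>2"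
    using eventually_at_right_less[of 0]
  proof eventually_elim
    case (elim h)
    have "T h \<psi> \<bullet> \<psi> \<le> norm (T h \<psi>) * norm \<psi>"
      by (rule norm_cauchy_schwarz)
    also have "\<dots> \<le> (exp (\<omega> * h) * norm \<psi>) * norm \<psi>"
      using elim by (intro mult_right_mono C0_semigroup_norm_le[OF bound]) auto
    finally have "T h \<psi> \<bullet> \<psi> - \<psi> \<bullet> \<psi> \<le> (exp (\<omega> * h) - 1) * (norm \<psi>)\<^sup>2"
      by (simp add: left_diff_distrib power2_eq_square mult.assoc flip: power2_norm_eq_inner)
    then have "(T h \<psi> \<bullet> \<psi> - \<psi> \<bullet> \<psi>) / h \<le> (exp (\<omega> * h) - 1) * (norm \<psi>)\<^sup>2 / h"
      using elim by (intro divide_right_mono) auto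
    then show ?case
      by (simp add: inner_diff_left divide_inverse mult_ac)
  qed
qed simp

text \<open>The quantitative form of injectivity of \<open>1 - h * G\<close> for the generator \<open>G\<close>: for \<open>h * \<omega> < 1\<close> resolvents,
  where they exist, have norm at most \<open>1 / (1 - h * \<omega>)\<close>. It follows from dissipativity by pairing
  \<open>\<psi> - h * G \<psi>\<close> with \<open>\<psi>\<close>.\<close>

lemma generator_expansive:
  assumes bound: "\<And>t. 0 \<le> t \<Longrightarrow> norm (T t) \<le> exp (\<omega> * t)"
    and gen: "(\<psi>, \<eta>) \<in> generator T" and h: "0 \<le> h"
  shows "(1 - h * \<omega>) * norm \<psi> \<le> norm (\<psi> - h *\<^sub>R \<eta>)"
proof (cases "\<psi> = 0")
  case False
  have "h * (\<eta> \<bullet> \<psi>) \<le> h * (\<omega> * (norm \<psi>)\<^sup>2)"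
    using generator_dissipative[OF bound gen] h by (intro mult_left_mono) auto
  then have "(1 - h * \<omega>) * norm \<psi> * norm \<psi> \<le> (\<psi> - h *\<^sub>R \<eta>) \<bullet> \<psi>"
    by (simp add: inner_diff_left algebra_simps power2_eq_square flip: power2_norm_eq_inner)
  also have "\<dots> \<le> norm (\<psi> - h *\<^sub>R \<eta>) * norm \<psi>"
    by (rule norm_cauchy_schwarz)
  finally show ?thesis
    using False by simp
qed simp

text \<open>The contraction factor \<open>1 - h * \<omega>\<close> of one resolvent step is traded for an exponential with a
  slightly larger rate, which is multiplicative in time.\<close>

lemma exp_neg_le_one_minus:
  fixes \<omega> :: real
  shows "\<forall>\<^sub>F h in at_right 0. exp (- (\<omega> + 1) * h) \<le> 1 - h * \<omega> "
proof -
  have "((\<lambda>h. exp (- (\<omega> + 1) * h) + h * \<omega>) has_real_derivative -1) (at 0)"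
    by (auto intro!: derivative_eq_intros)
  then obtain d where "d > 0" "\<And>h. 0 < h \<Longrightarrow> h < d \<Longrightarrow> exp (- (\<omega> + 1) * h) + h * \<omega> < 1"
    using DERIV_neg_dec_right[of "\<lambda>h. exp (- (\<omega> + 1) * h) + h * \<omega>" "-1" 0] by auto
  then show ?thesis
    unfolding eventually_at_right[OF zero_less_one] by (intro exI[of _ d]) (auto simp: algebra_simps less_imp_le add.commute)
qed

lemma infdist_le_of_near:
  fixes K K0 :: "'a::metric_space set"
  assumes "K \<noteq> {}" "K \<subseteq> closure K0"
    and near: "\<And>k. k \<in> K0 \<Longrightarrow> c * b \<le> r + dist u k"
  shows "c * b \<le> r + infdist u K"
proof -
  have "c * b - r \<le> dist u x" if "x \<in> K" for x
  proof -
    obtain k where k: "\<And>n. k n \<in> K0" "k \<longlonglongrightarrow> x"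
      using \<open>x \<in> K\<close> assms(2) closure_sequential[of x K0] by blast
    have "(\<lambda>n. dist u (k n)) \<longlonglongrightarrow> dist u x"
      using k by (intro tendsto_intros)
    moreover have "c * b - r \<le> dist u (k n)" for n
      using near[OF k(1)[of n]] by linarith
    ultimately show ?thesis
      by (intro LIMSEQ_le_const) auto
  qed
  then have "c * b - r \<le> infdist u K"
    using \<open>K \<noteq> {}\<close> by (auto simp: infdist_def intro!: cINF_greatest)
  then show ?thesis by linarith
qed

text \<open>For \<open>u\<close> in the domain of the generator \<open>G\<close>, the vector \<open>T h u\<close> almost solves the resolvent
  equation with right-hand side \<open>u\<close>, because \<open>T h u - h * G (T h u) = u + o(h)\<close>. If \<open>w \<in> K\<close> solves
  \<open>w - h * G w = k\<close>, expansivity bounds \<open>(1 - h * \<omega>) * norm (T h u - w)\<close> by \<open>norm (u - k) + o(h)\<close>.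
  Minimising over \<open>k\<close> shows that the distance to \<open>K\<close> grows at most exponentially along an orbit.
  The set \<open>K0\<close> collects right-hand sides for which the solution is explicit; they only have to approximate
  the elements of \<open>K\<close>.\<close>

lemma infdist_orbit_le:
  assumes sg: "C0_semigroup T"
    and \<omega>: "0 \<le> \<omega>" "\<And>t. 0 \<le> t \<Longrightarrow> norm (T t) \<le> exp (\<omega> * t)"
    and K: "K \<noteq> {}" "K \<subseteq> closure K0"
    and resolvent: "\<forall>\<^sub>F h in at_right 0. \<forall>k\<in>K0. \<exists>w\<in>K. \<exists>z. (w, z) \<in> generator T \<and> w - h *\<^sub>R z = k"
    and gen: "(\<psi>, \<eta>) \<in> generator T" and t: "0 \<le> t"
  shows "infdist (T t \<psi>) K \<le> exp ((\<omega> + 1) * t) * infdist \<psi> K"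
proof -
  define F where "F s = exp (- (\<omega> + 1) * s) * infdist (T s \<psi>) K" for s
  have "quasi_contractive T" using \<omega> by (auto simp: quasi_contractive_def)
  then have "continuous_on {0..} F"
    unfolding F_def by (intro continuous_intros continuous_on_infdist C0_semigroup_continuous_orbit[OF sg])
  moreover have "\<forall>\<^sub>F h in at_right 0. F (s + h) \<le> F s + e * h" if s: "0 \<le> s" and e: "0 < e" for s e
  proof -
    let ?u = "T s \<psi>" and ?v = "T s \<eta>"
    have uv: "(?u, ?v) \<in> generator T"
      by (rule generator_orbit[OF sg gen s])
    then have "((\<lambda>h. (T h ?u - ?u) /\<^sub>R h - T h ?v) \<longlongrightarrow> ?v - ?v) (at_right 0)"
      by (intro tendsto_diff C0_semigroup_tendsto[OF sg]) (simp add: generator_def)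
    then have "\<forall>\<^sub>F h in at_right 0. norm ((T h ?u - ?u) /\<^sub>R h - T h ?v) < e"
      using e by (auto simp: tendsto_iff dist_norm)
    moreover have "\<forall>\<^sub>F h in at_right 0. exp (- (\<omega> + 1) * h) \<le> 1 - h * \<omega>"
      by (rule exp_neg_le_one_minus)
    ultimately show ?thesis
      using resolvent eventually_at_right_less[of 0]
    proof eventually_elim
      case (elim h)
      \<comment> \<open>the defect of \<open>T h u\<close> in the resolvent equation\<close>
      have "norm (T h ?u - ?u - h *\<^sub>R T h ?v) = h * norm ((T h ?u - ?u) /\<^sub>R h - T h ?v)"
      proof -
        have "T h ?u - ?u - h *\<^sub>R T h ?v = h *\<^sub>R ((T h ?u - ?u) /\<^sub>R h - T h ?v)"
          using elim(4) by (simp add: scaleR_diff_right)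
        then show ?thesis using elim(4) by simp
      qed
      also have "\<dots> \<le> h * e"
        using elim by (intro mult_left_mono) auto
      finally have small: "norm (T h ?u - ?u - h *\<^sub>R T h ?v) \<le> h * e" .
      have pos: "0 \<le> 1 - h * \<omega>"
        using elim(2) exp_ge_zero order_trans by blast
      have "(1 - h * \<omega>) * infdist (T h ?u) K \<le> h * e + infdist ?u K"
      proof (rule infdist_le_of_near[OF K])
        fix k assume "k \<in> K0"
        then obtain w z where w: "w \<in> K" "(w, z) \<in> generator T" "w - h *\<^sub>R z = k"
          using elim by blast
        have "(1 - h * \<omega>) * infdist (T h ?u) K \<le> (1 - h * \<omega>) * norm (T h ?u - w)"
          using pos w(1) by (intro mult_left_mono) (auto simp: infdist_le simp flip: dist_norm)
        also have "\<dots> \<le> norm ((T h ?u - w) - h *\<^sub>R (T h ?v - z))"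
          using elim w by (intro generator_expansive[OF \<omega>(2)] generator_diff generator_orbit[OF sg uv]) auto
        also have "(T h ?u - w) - h *\<^sub>R (T h ?v - z) = (T h ?u - ?u - h *\<^sub>R T h ?v) + (?u - k)"
          by (simp add: w(3)[symmetric] algebra_simps)
        also have "norm \<dots> \<le> h * e + dist ?u k"
          unfolding dist_norm by (intro norm_triangle_mono small order_refl)
        finally show "(1 - h * \<omega>) * infdist (T h ?u) K \<le> h * e + dist ?u k" .
      qed
      moreover have "exp (- (\<omega> + 1) * h) * infdist (T h ?u) K \<le> (1 - h * \<omega>) * infdist (T h ?u) K"
        using elim(2) by (intro mult_right_mono infdist_nonneg)
      ultimately have "exp (- (\<omega> + 1) * h) * infdist (T h ?u) K \<le> h * e + infdist ?u K"
        by linarith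
      then have "exp (- (\<omega> + 1) * s) * (exp (- (\<omega> + 1) * h) * infdist (T h ?u) K)
          \<le> exp (- (\<omega> + 1) * s) * (h * e + infdist ?u K)"
        by (intro mult_left_mono) auto
      moreover have "exp (- (\<omega> + 1) * s) * (h * e) \<le> 1 * (h * e)"
        using \<omega> s e elim(4) by (intro mult_right_mono) (auto simp: mult_nonpos_nonneg)
      moreover have "T (s + h) \<psi> = T h ?u"
        using C0_semigroup_add[OF sg, of h s \<psi>] s elim(4) by (simp add: add.commute)
      moreover have "exp (- (\<omega> + 1) * (s + h)) = exp (- (\<omega> + 1) * s) * exp (- (\<omega> + 1) * h)"
        by (simp only: exp_add distrib_left)
      ultimately show ?case
        unfolding F_def by (simp only: distrib_left mult_1_left mult.assoc mult.commute[of h e])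
    qed
  qed
  ultimately have "F t \<le> F 0"
    using t by (rule le_initial_value_if_right_slope_nonpos)
  then have "exp ((\<omega> + 1) * t) * F t \<le> exp ((\<omega> + 1) * t) * F 0"
    by (rule mult_left_mono) simp
  moreover have "exp ((\<omega> + 1) * t) * F t = infdist (T t \<psi>) K"
    unfolding F_def mult.assoc[symmetric] mult_exp_exp by (simp add: algebra_simps)
  moreover have "F 0 = infdist \<psi> K"
    using sg by (simp add: F_def C0_semigroup_def)
  ultimately show ?thesis
    by (simp only:)
qed

text \<open>Only vectors in the domain have differentiable orbits, and \<open>\<psi>\<close> need not be one. It is approximated
  by vectors \<open>u n\<close> of the domain, possibly outside \<open>K\<close>; since the distance estimate holds for them as
  well, it survives the limit.\<close>

proposition semigroup_invariant_if_resolvent_invariant: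
  assumes sg: "C0_semigroup T" and qc: "quasi_contractive T"
    and dense: "closure (Domain (generator T)) = UNIV"
    and K: "closed K" "K \<noteq> {}" "K \<subseteq> closure K0"
    and resolvent: "\<forall>\<^sub>F h in at_right 0. \<forall>k\<in>K0. \<exists>w\<in>K. \<exists>z. (w, z) \<in> generator T \<and> w - h *\<^sub>R z = k"
    and \<psi>: "\<psi> \<in> K" and t: "0 \<le> t"
  shows "T t \<psi> \<in> K"
proof -
  obtain \<omega> where \<omega>: "0 \<le> \<omega>" "\<And>t. 0 \<le> t \<Longrightarrow> norm (T t) \<le> exp (\<omega> * t)"
    using quasi_contractiveE[OF qc] by blast
  obtain u where u: "\<And>n. u n \<in> Domain (generator T)" "u \<longlonglongrightarrow> \<psi>"
    using dense by (metis UNIV_I closure_sequential)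
  have le: "infdist (T t (u n)) K \<le> exp ((\<omega> + 1) * t) * infdist (u n) K" for n
    using u(1)[of n] infdist_orbit_le[OF sg \<omega> K(2,3) resolvent _ t] by blast
  have "infdist (T t \<psi>) K \<le> exp ((\<omega> + 1) * t) * infdist \<psi> K"
    by (rule LIMSEQ_le[of "\<lambda>n. infdist (T t (u n)) K" _ "\<lambda>n. exp ((\<omega> + 1) * t) * infdist (u n) K"])
      (use u(2) le in \<open>auto intro!: tendsto_intros tendsto_infdist blinfun.tendsto\<close>)
  then have "infdist (T t \<psi>) K = 0"
    using infdist_nonneg[of "T t \<psi>" K] \<psi> by simp
  then show ?thesis
    using K in_closed_iff_infdist_zero by blast
qed

section \<open>Classical functions as elements of the Hilbert space\<close>

lemma AE_half_line_iff: "(AE x in half_line. P x) \<longleftrightarrow> (AE x in lborel. 0 \<le> x \<longrightarrow> P x)"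
  by (subst AE_restrict_space_iff) auto

lemma ae_eq_refl_iff: "ae_eq u u \<longleftrightarrow> sq_integrable u"
  by (simp add: ae_eq_def)

lemma L2h_cases:
  obtains u where "sq_integrable u" "f = abs_L2h u"
  using Quotient3_abs_rep[OF Quotient3_L2h, of f] Quotient3_rep_reflp[OF Quotient3_L2h, of f]
  by (metis ae_eq_refl_iff)

lemma abs_L2h_diff:
  "sq_integrable u \<Longrightarrow> sq_integrable v \<Longrightarrow> abs_L2h u - abs_L2h v = abs_L2h (\<lambda>x. u x - v x)"
  by (simp add: minus_L2h.abs_eq ae_eq_refl_iff)

lemma abs_L2h_scaleR:
  "sq_integrable u \<Longrightarrow> r *\<^sub>R abs_L2h u = abs_L2h (\<lambda>x. r *\<^sub>R u x)"
  by (simp add: scaleR_L2h.abs_eq ae_eq_refl_iff)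

lemma inner_abs_L2h:
  "sq_integrable u \<Longrightarrow> sq_integrable v \<Longrightarrow> abs_L2h u \<bullet> abs_L2h v = (LINT x|half_line. u x \<bullet> v x)"
  by (simp add: inner_L2h.abs_eq ae_eq_refl_iff)

lemma norm_abs_L2h:
  assumes "sq_integrable u"
  shows "(norm (abs_L2h u))\<^sup>2 = (LINT x|half_line. (norm (u x))\<^sup>2)"
  by (simp add: power2_norm_eq_inner inner_abs_L2h assms)

lemma norm_diff_abs_L2h:
  assumes "sq_integrable u" "sq_integrable v"
  shows "(norm (abs_L2h u - abs_L2h v))\<^sup>2 = (LINT x|half_line. (norm (u x - v x))\<^sup>2)"
  using assms by (simp add: abs_L2h_diff norm_abs_L2h sq_integrable_diff)

text \<open>Pointwise domination of absolute values passes to norms; this makes pointwise nonexpansive maps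
  nonexpansive on the space.\<close>

lemma norm_abs_L2h_mono:
  assumes "sq_integrable u" "sq_integrable v" "AE x in half_line. norm (u x) \<le> norm (v x)"
  shows "norm (abs_L2h u) \<le> norm (abs_L2h v)"
proof (rule power2_le_imp_le)
  have "AE x in half_line. (norm (u x))\<^sup>2 \<le> (norm (v x))\<^sup>2"
    using assms(3) by eventually_elim (simp add: power_mono)
  then show "(norm (abs_L2h u))\<^sup>2 \<le> (norm (abs_L2h v))\<^sup>2"
    using assms(1,2) unfolding norm_abs_L2h[OF assms(1)] norm_abs_L2h[OF assms(2)]
    by (intro integral_mono_AE) (auto simp: sq_integrable_def)
qed simp

lemma borel_measurable_half_line_continuous:
  fixes u :: "real \<Rightarrow> 'a::real_normed_vector"
  assumes "continuous_on {0..} u"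
  shows "u \<in> borel_measurable half_line"
  using borel_measurable_continuous_on_restrict[OF assms]
  by (simp add: measurable_def space_restrict_space sets_restrict_space)

lemma integrable_half_line_exp:
  assumes "0 < c"
  shows "integrable half_line (\<lambda>x. exp (- c * x) :: real)"
proof (rule integrableI_bounded)
  have "((\<lambda>x. - exp (- c * x) / c) \<longlongrightarrow> - 0 / c) at_top"
    using assms by (intro tendsto_intros filterlim_compose[OF exp_at_bot]
      filterlim_tendsto_neg_mult_at_bot[OF tendsto_const _ filterlim_ident]) auto
  then have "(\<integral>\<^sup>+x. ennreal (exp (- c * x)) * indicator {0..} x \<partial>lborel) = - 0 / c - - exp (- c * 0) / c"
    using assms by (intro nn_integral_FTC_atLeast) (auto intro!: derivative_eq_intros)
  then show "(\<integral>\<^sup>+x. ennreal (norm (exp (- c * x))) \<partial>half_line) < \<infinity>"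
    by (simp add: nn_integral_restrict_space)
qed (auto intro!: borel_measurable_half_line_continuous continuous_intros)

text \<open>All explicit functions below are continuous with an exponential bound. This class is closed
  under the needed operations and is contained in the square integrable functions.\<close>

definition decaying :: "(real \<Rightarrow> complex) \<Rightarrow> bool"
  where "decaying u \<longleftrightarrow> continuous_on {0..} u \<and>
    (\<exists>C c. 0 < c \<and> (\<forall>x\<ge>0. norm (u x) \<le> C * exp (- c * x)))"

text \<open>On a bounded interval continuity supplies the bound.\<close>

lemma decayingI:
  assumes u: "continuous_on {0..} u" and c: "0 < c"
    and far: "\<And>x. 0 \<le> x \<Longrightarrow> R \<le> x \<Longrightarrow> norm (u x) \<le> C * exp (- c * x)"
  shows "decaying u"
proof -
  have "compact (u ` {0..R})"
    by (intro compact_continuous_image continuous_on_subset[OF u]) auto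
  then obtain B where B: "\<And>x. x \<in> {0..R} \<Longrightarrow> norm (u x) \<le> B"
    by (meson bounded_iff compact_imp_bounded image_eqI)
  have "norm (u x) \<le> max C (\<bar>B\<bar> * exp (c * R)) * exp (- c * x)" if x: "0 \<le> x" for x
  proof (cases "R \<le> x")
    case True
    have "C * exp (- c * x) \<le> max C (\<bar>B\<bar> * exp (c * R)) * exp (- c * x)"
      by (intro mult_right_mono) auto
    with far[OF x True] show ?thesis by linarith
  next
    case False
    have "norm (u x) \<le> \<bar>B\<bar> * 1"
      using B[of x] x False by auto
    also have "\<dots> \<le> \<bar>B\<bar> * exp (c * R - c * x)"
      using False c by (intro mult_left_mono) auto
    also have "\<dots> = (\<bar>B\<bar> * exp (c * R)) * exp (- c * x)"
      by (simp add: exp_diff exp_minus divide_inverse)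
    also have "\<dots> \<le> max C (\<bar>B\<bar> * exp (c * R)) * exp (- c * x)"
      by (intro mult_right_mono) auto
    finally show ?thesis .
  qed
  then show ?thesis
    using u c by (auto simp: decaying_def)
qed

lemma decaying_continuous: "decaying u \<Longrightarrow> continuous_on {0..} u"
  by (simp add: decaying_def)

lemma decaying_exp:
  assumes "0 < c"
  shows "decaying (\<lambda>x. a * of_real (exp (- c * x)))"
  by (rule decayingI[of _ c 0 "norm a"]) (auto intro!: continuous_intros simp: assms norm_mult)

lemma decaying_add:
  assumes "decaying u" "decaying v"
  shows "decaying (\<lambda>x. u x + v x)"
proof -
  from assms obtain C c C' c' where
    u: "0 < c" "\<And>x. 0 \<le> x \<Longrightarrow> norm (u x) \<le> C * exp (- c * x)" and
    v: "0 < c'" "\<And>x. 0 \<le> x \<Longrightarrow> norm (v x) \<le> C' * exp (- c' * x)"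
    by (auto simp: decaying_def)
  have C: "0 \<le> C" "0 \<le> C'"
    using order_trans[OF norm_ge_zero u(2)[of 0]] order_trans[OF norm_ge_zero v(2)[of 0]] by auto
  have "norm (u x + v x) \<le> (C + C') * exp (- min c c' * x)" if x: "0 \<le> x" for x
  proof -
    have "C * exp (- c * x) \<le> C * exp (- min c c' * x)" "C' * exp (- c' * x) \<le> C' * exp (- min c c' * x)"
      using x C by (auto intro!: mult_left_mono mult_right_mono)
    then show ?thesis
      using norm_triangle_ineq[of "u x" "v x"] u(2)[OF x] v(2)[OF x] unfolding distrib_right by linarith
  qed
  moreover have "continuous_on {0..} (\<lambda>x. u x + v x)"
    using assms by (intro continuous_intros decaying_continuous)
  ultimately show ?thesis
    using u(1) v(1) unfolding decaying_def by (intro conjI exI[of _ "C + C'"] exI[of _ "min c c'"]) auto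
qed

lemma decaying_mult_left:
  assumes "decaying u"
  shows "decaying (\<lambda>x. a * u x)"
proof -
  from assms obtain C c where
    u: "0 < c" "\<And>x. 0 \<le> x \<Longrightarrow> norm (u x) \<le> C * exp (- c * x)"
    by (auto simp: decaying_def)
  show ?thesis
  proof (rule decayingI[OF _ u(1)])
    show "continuous_on {0..} (\<lambda>x. a * u x)"
      using assms by (intro continuous_intros decaying_continuous)
    show "norm (a * u x) \<le> (norm a * C) * exp (- c * x)" if "0 \<le> x" for x
      using u(2)[OF that] by (simp add: norm_mult mult.assoc mult_left_mono)
  qed
qed

lemma decaying_sq_integrable:
  assumes "decaying u"
  shows "sq_integrable u"
proof -
  from assms obtain C c where
    u: "0 < c" "\<And>x. 0 \<le> x \<Longrightarrow> norm (u x) \<le> C * exp (- c * x)"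
    by (auto simp: decaying_def)
  have meas: "u \<in> borel_measurable half_line"
    using assms by (intro borel_measurable_half_line_continuous decaying_continuous)
  have "integrable half_line (\<lambda>x. (norm (u x))\<^sup>2)"
  proof (rule Bochner_Integration.integrable_bound)
    show "integrable half_line (\<lambda>x. C\<^sup>2 * exp (- (2 * c) * x))"
      using u(1) by (intro integrable_mult_right integrable_half_line_exp) simp
    have "(norm (u x))\<^sup>2 \<le> C\<^sup>2 * exp (- (2 * c) * x)" if "0 \<le> x" for x
    proof -
      have "(norm (u x))\<^sup>2 \<le> (C * exp (- c * x))\<^sup>2"
        using u(2)[OF that] by (intro power_mono) auto
      also have "\<dots> = C\<^sup>2 * exp (- (2 * c) * x)"
        by (simp add: power_mult_distrib mult.assoc flip: exp_double)
      finally show ?thesis .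
    qed
    then show "AE x in half_line. norm ((norm (u x))\<^sup>2) \<le> norm (C\<^sup>2 * exp (- (2 * c) * x))"
      by (intro AE_I2) (auto simp: space_restrict_space)
  qed (use meas in measurable)
  with meas show ?thesis by (simp add: sq_integrable_def)
qed

text \<open>The support, being compact in the open half line, fits into a bounded interval away from zero,
  and the derivative vanishes off that interval too.\<close>

lemma test_functionE:
  assumes "test_function \<phi>"
  obtains D a b where "0 < a" "a \<le> b"
    "\<And>x. (\<phi> has_real_derivative D x) (at x)" "continuous_on UNIV D"
    "\<And>x. x \<notin> {a<..<b} \<Longrightarrow> \<phi> x = 0" "\<And>x. x \<notin> {a<..<b} \<Longrightarrow> D x = 0"
proof -
  let ?K = "closure {x. \<phi> x \<noteq> 0}"
  have K: "compact ?K" "?K \<subseteq> {0<..}"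
    using assms by (auto simp: test_function_def)
  obtain D where D: "\<And>x. (\<phi> has_real_derivative D x) (at x)" "continuous_on UNIV D"
    using assms by (auto simp: test_function_def C1_differentiable_on_def
      has_real_derivative_iff_has_vector_derivative)
  obtain a b where ab: "0 < a" "a \<le> b" "?K \<subseteq> {a<..<b}"
  proof (cases "?K = {}")
    case True
    then show thesis by (intro that[of 1 1]) auto
  next
    case False
    obtain l where l: "l \<in> ?K" "\<And>x. x \<in> ?K \<Longrightarrow> l \<le> x"
      using compact_attains_inf[OF K(1) False] by blast
    obtain u where u: "u \<in> ?K" "\<And>x. x \<in> ?K \<Longrightarrow> x \<le> u"
      using compact_attains_sup[OF K(1) False] by blast
    have "0 < l" "l \<le> u" using K(2) l u by auto
    moreover have "l / 2 < x \<and> x < u + 1" if "x \<in> ?K" for x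
      using l(2)[OF that] u(2)[OF that] \<open>0 < l\<close> by linarith
    ultimately show thesis
      by (intro that[of "l / 2" "u + 1"]) auto
  qed
  have zero: "\<phi> x = 0" if "x \<notin> ?K" for x
    using that closure_subset[of "{x. \<phi> x \<noteq> 0}"] by blast
  have "D x = 0" if "x \<notin> ?K" for x
  proof -
    have "(\<phi> has_real_derivative 0) (at x)"
    proof (rule has_field_derivative_transform_within_open[of "\<lambda>x. 0" _ _ "- ?K"])
      show "0 = \<phi> y" if "y \<in> - ?K" for y
        using zero[of y] that by (metis ComplD)
    qed (use that in \<open>simp_all add: open_Compl\<close>)
    with D(1) show ?thesis by (rule DERIV_unique)
  qed
  moreover have "x \<notin> ?K" if "x \<notin> {a<..<b}" for x
    using ab(3) that by blast
  ultimately show thesis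
    using zero by (intro that[OF ab(1,2) D]) meson+
qed

text \<open>Integration by parts on an interval containing the support of the test function in its interior;
  the boundary terms vanish there.\<close>

lemma has_weak_deriv_of_derivative:
  assumes u: "decaying u" and v: "decaying v"
    and deriv: "\<And>x. 0 < x \<Longrightarrow> (u has_vector_derivative v x) (at x)"
  shows "has_weak_deriv (abs_L2h u) (abs_L2h v)"
proof -
  have "(LINT x|half_line. deriv \<phi> x *\<^sub>R u x) = - (LINT x|half_line. \<phi> x *\<^sub>R v x)"
    if "test_function \<phi>" for \<phi>
  proof -
    from test_functionE[OF \<open>test_function \<phi>\<close>] obtain D a b where ab: "0 < a" "a \<le> b"
      and D: "\<And>x. (\<phi> has_real_derivative D x) (at x)" "continuous_on UNIV D"
      and zero: "\<And>x. x \<notin> {a<..<b} \<Longrightarrow> \<phi> x = 0" "\<And>x. x \<notin> {a<..<b} \<Longrightarrow> D x = 0"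
      by metis
    have [simp]: "deriv \<phi> = D"
      using D(1) by (auto intro: DERIV_imp_deriv)
    have cont: "continuous_on {a..b} u" "continuous_on {a..b} v" "continuous_on {a..b} \<phi>" "continuous_on {a..b} D"
      using ab decaying_continuous[OF u] decaying_continuous[OF v] D
      by (auto intro: continuous_on_subset DERIV_continuous_on has_field_derivative_at_within)
    have restrict: "(LINT x|half_line. f x *\<^sub>R w x) = (LINT x|lborel. indicator {a..b} x *\<^sub>R (f x *\<^sub>R w x))"
      if "\<And>x. x \<notin> {a<..<b} \<Longrightarrow> f x = 0" for f and w :: "real \<Rightarrow> complex"
      using that ab by (subst integral_restrict_space)
        (auto intro!: Bochner_Integration.integral_cong simp: indicator_def)
    have "integrable lborel (\<lambda>x. indicator {a..b} x *\<^sub>R (D x *\<^sub>R u x))"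
      "integrable lborel (\<lambda>x. indicator {a..b} x *\<^sub>R (\<phi> x *\<^sub>R v x))"
      by (intro borel_integrable_compact continuous_intros cont; simp)+
    then have "(LINT x|lborel. indicator {a..b} x *\<^sub>R (D x *\<^sub>R u x)) +
        (LINT x|lborel. indicator {a..b} x *\<^sub>R (\<phi> x *\<^sub>R v x)) =
        (LINT x|lborel. indicator {a..b} x *\<^sub>R (\<phi> x *\<^sub>R v x + D x *\<^sub>R u x))"
      by (simp add: scaleR_add_right)
    also have "\<dots> = \<phi> b *\<^sub>R u b - \<phi> a *\<^sub>R u a"
    proof (rule integral_FTC_Icc[OF ab(2)])
      fix x assume "a \<le> x" "x \<le> b"
      then show "((\<lambda>x. \<phi> x *\<^sub>R u x) has_vector_derivative \<phi> x *\<^sub>R v x + D x *\<^sub>R u x) (at x within {a..b})"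
        using ab by (intro has_vector_derivative_scaleR has_field_derivative_at_within[OF D(1)]
          has_vector_derivative_at_within[OF deriv]) auto
    qed (intro continuous_intros cont)
    also have "\<dots> = 0" using zero by simp
    finally have "(LINT x|lborel. indicator {a..b} x *\<^sub>R (D x *\<^sub>R u x)) +
        (LINT x|lborel. indicator {a..b} x *\<^sub>R (\<phi> x *\<^sub>R v x)) = 0" .
    moreover have "(LINT x|half_line. D x *\<^sub>R u x) = (LINT x|lborel. indicator {a..b} x *\<^sub>R (D x *\<^sub>R u x))"
      by (rule restrict) (rule zero(2))
    moreover have "(LINT x|half_line. \<phi> x *\<^sub>R v x) = (LINT x|lborel. indicator {a..b} x *\<^sub>R (\<phi> x *\<^sub>R v x))"
      by (rule restrict) (rule zero(1))
    ultimately have "(LINT x|half_line. D x *\<^sub>R u x) + (LINT x|half_line. \<phi> x *\<^sub>R v x) = 0"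
      by (simp only:)
    then show ?thesis
      by (simp add: eq_neg_iff_add_eq_0)
  qed
  then show ?thesis
    using u v by (simp add: has_weak_deriv.abs_eq ae_eq_refl_iff decaying_sq_integrable)
qed

text \<open>Two continuous functions that differ at the endpoint differ on an interval of positive length.\<close>

lemma continuous_AE_eq_at_zero:
  fixes u v :: "real \<Rightarrow> complex"
  assumes "continuous_on {0..} u" "continuous_on {0..} v" "AE x in half_line. u x = v x"
  shows "u 0 = v 0"
proof (rule ccontr)
  assume "u 0 \<noteq> v 0"
  moreover have "continuous_on {0..} (\<lambda>x. dist (u x) (v x))"
    by (intro continuous_intros assms)
  ultimately obtain d where "0 < d" and
    d': "\<forall>x\<in>{0..}. dist x 0 < d \<longrightarrow> dist (dist (u x) (v x)) (dist (u 0) (v 0)) < dist (u 0) (v 0)"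
    unfolding continuous_on_iff by (metis atLeast_iff order_refl zero_less_dist_iff)
  then have d: "0 < d" "\<And>x. 0 \<le> x \<Longrightarrow> x < d \<Longrightarrow> u x \<noteq> v x"
    by (force simp: dist_real_def)+
  have "AE x in lborel. x \<notin> {0<..<d}"
    using assms(3) unfolding AE_half_line_iff
  proof eventually_elim
    case (elim x)
    then show ?case using d(2)[of x] by auto
  qed
  then have "emeasure lborel {x\<in>space lborel. \<not> x \<notin> {0<..<d}} = 0"
    by (subst (asm) AE_iff_measurable[OF _ refl]) auto
  moreover have "{x\<in>space lborel. \<not> x \<notin> {0<..<d}} = {0<..<d}"
    by auto
  ultimately have "emeasure lborel {0<..<d} = 0"
    by simp
  with d(1) show False by simp
qed

lemma at_zero_abs_L2h:
  assumes u: "continuous_on {0..} u" and "sq_integrable u"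
  shows "at_zero (abs_L2h u) = u 0"
proof -
  have "(THE c. \<exists>v. continuous_on {0..} v \<and> (AE x in half_line. v x = u x) \<and> v 0 = c) = u 0"
    by (rule the_equality) (use u in \<open>auto intro: continuous_AE_eq_at_zero\<close>)
  then show ?thesis
    using assms by (simp add: at_zero.abs_eq ae_eq_refl_iff)
qed

section \<open>Density of compactly supported functions\<close>

lemma sq_integrable_borel: "sq_integrable u \<Longrightarrow> u \<in> borel_measurable half_line"
  by (simp add: sq_integrable_def)

lemma has_real_derivative_positive_part_power:
  "((\<lambda>y::real. max 0 y ^ Suc (Suc n)) has_real_derivative real (Suc (Suc n)) * max 0 y ^ Suc n) (at y)"
proof (cases y "0::real" rule: linorder_cases)
  case less
  have "((\<lambda>y::real. max 0 y ^ Suc (Suc n)) has_real_derivative 0) (at y)"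
    by (rule has_field_derivative_transform_within_open[of "\<lambda>x. 0" _ _ "{..<0}"]) (use less in auto)
  then show ?thesis using less by simp
next
  case greater
  have "((\<lambda>y::real. y ^ Suc (Suc n)) has_real_derivative real (Suc (Suc n)) * y ^ Suc n) (at y)"
    using DERIV_pow[of "Suc (Suc n)" y] by simp
  then have "((\<lambda>y::real. max 0 y ^ Suc (Suc n)) has_real_derivative real (Suc (Suc n)) * y ^ Suc n) (at y)"
    by (rule has_field_derivative_transform_within_open[of _ _ _ "{0<..}"]) (use greater in auto)
  then show ?thesis using greater by simp
next
  case equal
  have "((\<lambda>h::real. max 0 h ^ Suc (Suc n) / h) \<longlongrightarrow> 0) (at 0)"
  proof (rule Lim_null_comparison)
    have "norm (max 0 h ^ Suc (Suc n) / h) \<le> max 0 h ^ Suc n" for h :: real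
      by (cases "0 < h") (auto simp: max_def)
    then show "\<forall>\<^sub>F h in at 0. norm (max 0 h ^ Suc (Suc n) / h) \<le> max 0 (h::real) ^ Suc n"
      by (intro always_eventually) blast
    have "((\<lambda>h::real. max 0 h ^ Suc n) \<longlongrightarrow> max 0 0 ^ Suc n) (at 0)"
      by (intro tendsto_intros)
    then show "((\<lambda>h::real. max 0 h ^ Suc n) \<longlongrightarrow> 0) (at 0)"
      by simp
  qed
  then show ?thesis
    using equal by (simp add: DERIV_def)
qed

text \<open>Twice continuously differentiable functions with compact support in the open half line, given
  with their derivatives. They serve as test functions for weak derivatives and as elements of the
  domain of every Laplacian, since both traces vanish.\<close>

definition bump :: "(real \<Rightarrow> complex) \<Rightarrow> bool"
  where "bump u \<longleftrightarrow> (\<exists>u' u'' a b. 0 < a \<and> continuous_on UNIV u'' \<and>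
    (\<forall>x. (u has_vector_derivative u' x) (at x) \<and> (u' has_vector_derivative u'' x) (at x)) \<and>
    (\<forall>x. x \<notin> {a<..<b} \<longrightarrow> u x = 0 \<and> u' x = 0 \<and> u'' x = 0))"

text \<open>The cube of the positive part is twice continuously differentiable, so it turns a quadratic
  polynomial with roots \<open>a\<close> and \<open>b\<close> into a cutoff function.\<close>

lemma bump_polynomial:
  assumes "polynomial_function p" "0 < a" "a \<le> b"
  shows "bump (\<lambda>x. max 0 ((x - a) * (b - x)) ^ 3 *\<^sub>R p x)"
proof -
  obtain p' where p': "polynomial_function p'" "\<And>x. (p has_vector_derivative p' x) (at x)"
    using has_vector_derivative_polynomial_function[OF assms(1)] by blast
  obtain p'' where p'': "polynomial_function p''" "\<And>x. (p' has_vector_derivative p'' x) (at x)"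
    using has_vector_derivative_polynomial_function[OF p'(1)] by blast
  define q where "q x = (x - a) * (b - x)" for x
  have q: "(q has_real_derivative (a + b - 2 * x)) (at x)" for x
    unfolding q_def by (auto intro!: derivative_eq_intros)
  have q_neg: "q x \<le> 0" if "x \<notin> {a<..<b}" for x
    using that assms(3) unfolding q_def by (cases "x \<le> a") (auto intro: mult_nonpos_nonneg mult_nonneg_nonpos)
  define c where "c x = max 0 (q x) ^ 3" for x
  define c' where "c' x = 3 * max 0 (q x) ^ 2 * (a + b - 2 * x)" for x
  define c'' where "c'' x = 6 * max 0 (q x) * (a + b - 2 * x) ^ 2 - 6 * max 0 (q x) ^ 2" for x
  have c: "(c has_real_derivative c' x) (at x)" for x
    using DERIV_chain2[OF has_real_derivative_positive_part_power[of 1 "q x"] q]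
    unfolding c_def c'_def by (simp add: numeral_3_eq_3 numeral_2_eq_2 mult.assoc)
  have c': "(c' has_real_derivative c'' x) (at x)" for x
  proof -
    have "((\<lambda>x. max 0 (q x) ^ 2) has_real_derivative 2 * max 0 (q x) * (a + b - 2 * x)) (at x)"
      using DERIV_chain2[OF has_real_derivative_positive_part_power[of 0 "q x"] q]
      by (simp add: numeral_2_eq_2)
    moreover have "((\<lambda>x. a + b - 2 * x) has_real_derivative - 2) (at x)"
      by (auto intro!: derivative_eq_intros)
    ultimately show ?thesis
      unfolding c'_def c''_def
      by (rule DERIV_cong[OF DERIV_mult[OF DERIV_cmult]]) (simp add: power2_eq_square)
  qed
  have zero: "c x = 0" "c' x = 0" "c'' x = 0" if "x \<notin> {a<..<b}" for x
    using q_neg[OF that] by (auto simp: c_def c'_def c''_def max_def)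
  have cont: "continuous_on UNIV c''"
    unfolding c''_def q_def by (intro continuous_intros)
  have cont_c: "continuous_on UNIV c" "continuous_on UNIV c'"
    using c c' by (auto intro!: DERIV_continuous_on)
  have cont_p: "continuous_on UNIV p" "continuous_on UNIV p'" "continuous_on UNIV p''"
    using assms(1) p'(1) p''(1) by (auto intro: continuous_on_polymonial_function)
  show ?thesis
    unfolding bump_def q_def[symmetric] c_def[symmetric]
  proof (intro exI conjI allI impI)
    show "0 < a" by fact
    show "((\<lambda>x. c x *\<^sub>R p x) has_vector_derivative (c x *\<^sub>R p' x + c' x *\<^sub>R p x)) (at x)" for x
      by (intro has_vector_derivative_scaleR c p')
    show "((\<lambda>x. c x *\<^sub>R p' x + c' x *\<^sub>R p x) has_vector_derivative
        ((c x *\<^sub>R p'' x + c' x *\<^sub>R p' x) + (c' x *\<^sub>R p' x + c'' x *\<^sub>R p x))) (at x)" for x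
      by (intro has_vector_derivative_add has_vector_derivative_scaleR c c' p' p'')
    show "continuous_on UNIV (\<lambda>x. (c x *\<^sub>R p'' x + c' x *\<^sub>R p' x) + (c' x *\<^sub>R p' x + c'' x *\<^sub>R p x))"
      by (intro continuous_intros cont cont_c cont_p)
  qed (use zero in auto)
qed

text \<open>Dominated convergence in the square mean.\<close>

lemma abs_L2h_tendsto:
  assumes u: "sq_integrable u" and w: "sq_integrable w"
    and un: "\<And>n. sq_integrable (un n)"
    and bound: "\<And>n. AE x in half_line. norm (un n x) \<le> norm (w x)"
    and lim: "AE x in half_line. (\<lambda>n. un n x) \<longlonglongrightarrow> u x"
  shows "(\<lambda>n. abs_L2h (un n)) \<longlonglongrightarrow> abs_L2h u"
proof -
  note [measurable] = sq_integrable_borel[OF u] sq_integrable_borel[OF w] sq_integrable_borel[OF un]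
  have "(\<lambda>n. LINT x|half_line. (norm (un n x - u x))\<^sup>2) \<longlonglongrightarrow> (LINT x|half_line. 0)"
  proof (rule integral_dominated_convergence)
    show "integrable half_line (\<lambda>x. 2 * (norm (w x))\<^sup>2 + 2 * (norm (u x))\<^sup>2)"
      using u w by (auto simp: sq_integrable_def)
    show "AE x in half_line. (\<lambda>n. (norm (un n x - u x))\<^sup>2) \<longlonglongrightarrow> 0"
      using lim
    proof eventually_elim
      case (elim x)
      then have "(\<lambda>n. (norm (un n x - u x))\<^sup>2) \<longlonglongrightarrow> (norm (u x - u x))\<^sup>2"
        by (intro tendsto_intros)
      then show ?case by simp
    qed
    show "AE x in half_line. norm ((norm (un n x - u x))\<^sup>2) \<le> 2 * (norm (w x))\<^sup>2 + 2 * (norm (u x))\<^sup>2" for n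
      using bound[of n]
    proof eventually_elim
      case (elim x)
      then have "(norm (un n x - u x))\<^sup>2 \<le> (norm (w x) + norm (u x))\<^sup>2"
        using norm_triangle_ineq4[of "un n x" "u x"] by (intro power_mono) auto
      also have "\<dots> \<le> 2 * (norm (w x))\<^sup>2 + 2 * (norm (u x))\<^sup>2"
        using sum_squares_bound[of "norm (w x)" "norm (u x)"] by (simp add: power2_sum)
      finally show ?case by simp
    qed
  qed measurable
  then have "(\<lambda>n. (norm (abs_L2h (un n) - abs_L2h u))\<^sup>2) \<longlonglongrightarrow> 0"
    by (simp add: norm_diff_abs_L2h u un)
  then have "(\<lambda>n. sqrt ((norm (abs_L2h (un n) - abs_L2h u))\<^sup>2)) \<longlonglongrightarrow> sqrt 0"
    by (rule tendsto_real_sqrt)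
  then show ?thesis
    by (simp add: tendsto_norm_zero_iff LIM_zero_iff)
qed

lemma sq_integrable_bound:
  assumes "u \<in> borel_measurable half_line" "sq_integrable w"
    and "\<And>x. 0 \<le> x \<Longrightarrow> norm (u x) \<le> norm (w x)"
  shows "sq_integrable u"
proof -
  have "integrable half_line (\<lambda>x. (norm (u x))\<^sup>2)"
    by (rule Bochner_Integration.integrable_bound[of _ "\<lambda>x. (norm (w x))\<^sup>2"])
      (use assms in \<open>auto simp: sq_integrable_def space_restrict_space intro!: AE_I2 power_mono\<close>)
  with assms show ?thesis by (simp add: sq_integrable_def)
qed

lemma compact_support_decaying:
  assumes "continuous_on {0..} u" "\<And>x. R < x \<Longrightarrow> u x = 0"
  shows "decaying u"
  by (rule decayingI[of u 1 "R + 1" 0]) (use assms in auto)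

lemma AE_continuous_approx:
  fixes g :: "real \<Rightarrow> complex"
  assumes "g \<in> borel_measurable borel"
  obtains gn where "\<And>n::nat. continuous_on UNIV (gn n)" "AE x in lborel. (\<lambda>n. gn n x) \<longlonglongrightarrow> g x"
proof -
  have "g \<in> borel_measurable lebesgue"
    using assms by (intro measurable_completion) simp
  then have "g measurable_on UNIV"
    by (intro lebesgue_measurable_imp_measurable_on) auto
  then obtain N gn where N: "negligible N" "\<And>n. continuous_on UNIV (gn n)"
      "\<And>x. x \<notin> N \<Longrightarrow> (\<lambda>n. gn n x) \<longlonglongrightarrow> g x"
    unfolding measurable_on_def by auto
  have "AE x in lebesgue. x \<notin> N"
    using N(1) by (intro AE_not_in) (simp add: negligible_iff_null_sets)
  then have "AE x in lborel. x \<notin> N"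
    by (simp add: AE_completion_iff)
  then have "AE x in lborel. (\<lambda>n. gn n x) \<longlonglongrightarrow> g x"
    by eventually_elim (rule N(3))
  with N(2) show thesis by (rule that)
qed

text \<open>A bounded function \<open>u\<close> with compact support away from zero is written as \<open>c * g\<close> with a cutoff
  \<open>c\<close> that is bounded below on the support of \<open>u\<close>. The quotient \<open>g\<close> is bounded and measurable, hence an almost
  everywhere limit of continuous functions, which can be truncated to the bound of \<open>g\<close> and then
  replaced by polynomials \<open>p n\<close> by Weierstrass' theorem. The products \<open>c * p n\<close> are bumps and converge to \<open>u\<close>
  by dominated convergence.\<close>

lemma bounded_in_closure_bumps:
  assumes u: "sq_integrable u" and a: "0 < a" and b: "a \<le> b" and m: "0 \<le> m"
    and bound: "\<And>x. norm (u x) \<le> m" and supp: "\<And>x. x \<notin> {a..b} \<Longrightarrow> u x = 0"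
  shows "abs_L2h u \<in> closure {abs_L2h v |v. bump v}"
proof -
  define c where "c x = max 0 ((x - a / 2) * (b + 1 - x)) ^ 3" for x
  have c_pos: "(a / 2) ^ 3 \<le> c x" if "x \<in> {a..b}" for x
  proof -
    have "a / 2 * 1 \<le> (x - a / 2) * (b + 1 - x)"
      using that a by (intro mult_mono) auto
    then show ?thesis unfolding c_def using a by (intro power_mono) auto
  qed
  have c_nonneg: "0 \<le> c x" for x by (simp add: c_def)
  have c_zero: "c x = 0" if "x \<notin> {a / 2..b + 1}" for x
  proof -
    have "(x - a / 2) * (b + 1 - x) \<le> 0"
      using that a b by (cases "x < a / 2") (auto intro: mult_nonpos_nonneg mult_nonneg_nonpos)
    then show ?thesis by (simp add: c_def)
  qed
  have c_cont: "continuous_on S c" for S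
    unfolding c_def by (intro continuous_intros)
  define g where "g x = u x /\<^sub>R c x" for x
  define M where "M = m / (a / 2) ^ 3"
  have M: "0 \<le> M" using m a by (simp add: M_def)
  have g_bound: "norm (g x) \<le> M" for x
  proof (cases "x \<in> {a..b}")
    case True
    have "norm (u x) / c x \<le> m / (a / 2) ^ 3"
      using bound[of x] c_pos[OF True] a m by (intro frac_le) auto
    moreover have "norm (g x) = norm (u x) / c x"
      using c_nonneg[of x] by (simp add: g_def divide_inverse_commute)
    ultimately show ?thesis by (simp only: M_def)
  qed (simp add: g_def supp M)
  have cg: "c x *\<^sub>R g x = u x" for x
  proof (cases "x \<in> {a..b}")
    case True
    have "0 < (a / 2) ^ 3" using a by simp
    with c_pos[OF True] have "c x \<noteq> 0" by linarith
    then show ?thesis by (simp add: g_def)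
  qed (simp add: g_def supp)
  have "g = (\<lambda>x. indicator {0..} x *\<^sub>R u x /\<^sub>R c x)"
  proof
    fix x
    show "g x = indicator {0..} x *\<^sub>R u x /\<^sub>R c x"
      using supp[of x] a by (cases "0 \<le> x") (auto simp: g_def)
  qed
  moreover have "(\<lambda>x. indicator {0..} x *\<^sub>R u x) \<in> borel_measurable borel"
    using sq_integrable_borel[OF u] by (subst (asm) borel_measurable_restrict_space_iff) auto
  then have "(\<lambda>x. indicator {0..} x *\<^sub>R u x /\<^sub>R c x) \<in> borel_measurable borel"
    by (rule borel_measurable_scaleR[OF borel_measurable_inverse[OF borel_measurable_continuous_onI[OF c_cont]]])
  ultimately have "g \<in> borel_measurable borel"
    by (simp only:)
  then obtain gn where gn: "\<And>n::nat. continuous_on UNIV (gn n)"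
      "AE x in lborel. (\<lambda>n. gn n x) \<longlonglongrightarrow> g x"
    by (rule AE_continuous_approx) (rule that)
  \<comment> \<open>pointwise truncation to the bound \<open>M\<close> of \<open>g\<close>\<close>
  define hn where "hn n x = closest_point (cball 0 M) (gn n x)" for n x
  have cball: "convex (cball 0 M :: complex set)" "closed (cball 0 M :: complex set)" "cball 0 M \<noteq> ({} :: complex set)"
    using M by auto
  have hn_cont: "continuous_on S (hn n)" for n S
    unfolding hn_def
    by (rule continuous_on_compose2[OF continuous_on_closest_point[OF cball, of UNIV] continuous_on_subset[OF gn(1)]]) auto
  have hn_bound: "norm (hn n x) \<le> M" for n x
    using closest_point_in_set[OF cball(2,3), of "gn n x"] by (simp add: hn_def)
  have "\<exists>p. polynomial_function p \<and> (\<forall>x\<in>{a / 2..b + 1}. norm (hn n x - p x) < inverse (real (Suc n)))" for n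
    by (intro Stone_Weierstrass_polynomial_function hn_cont) auto
  then obtain p where p: "\<And>n. polynomial_function (p n)"
      "\<And>n x. x \<in> {a / 2..b + 1} \<Longrightarrow> norm (hn n x - p n x) < inverse (real (Suc n))"
    by metis
  have bump: "bump (\<lambda>x. c x *\<^sub>R p n x)" for n
    unfolding c_def using a b by (intro bump_polynomial p) auto
  have w: "sq_integrable (\<lambda>x. of_real (c x * (M + 1)))"
    using c_zero by (intro decaying_sq_integrable compact_support_decaying[of _ "b + 1"] continuous_intros c_cont) auto
  have pn_bound: "norm (c x *\<^sub>R p n x) \<le> norm (of_real (c x * (M + 1)) :: complex)" for n x
  proof (cases "x \<in> {a / 2..b + 1}")
    case True
    have "inverse (real (Suc n)) \<le> 1" by (simp add: inverse_le_1_iff)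
    then have "norm (p n x) \<le> M + 1"
      using norm_triangle_ineq2[of "p n x" "hn n x"] p(2)[OF True, of n] hn_bound[of n x]
      by (simp only: norm_minus_commute[of "p n x"])
    then show ?thesis
      using c_nonneg[of x] M unfolding norm_of_real norm_scaleR abs_mult by (intro mult_mono) auto
  qed (simp add: c_zero)
  have "(\<lambda>n. abs_L2h (\<lambda>x. c x *\<^sub>R p n x)) \<longlonglongrightarrow> abs_L2h u"
  proof (rule abs_L2h_tendsto[OF u w])
    show "sq_integrable (\<lambda>x. c x *\<^sub>R p n x)" for n
      using p(1) by (intro sq_integrable_bound[OF _ w] pn_bound borel_measurable_half_line_continuous
        continuous_intros c_cont continuous_on_polymonial_function)
    show "AE x in half_line. norm (c x *\<^sub>R p n x) \<le> norm (of_real (c x * (M + 1)) :: complex)" for n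
      using pn_bound by (intro AE_I2)
    have "AE x in lborel. (\<lambda>n. c x *\<^sub>R p n x) \<longlonglongrightarrow> u x"
      using gn(2)
    proof eventually_elim
      case (elim x)
      show ?case
      proof (cases "x \<in> {a / 2..b + 1}")
        case True
        have "continuous_on UNIV (closest_point (cball 0 M :: complex set))"
          by (rule continuous_on_closest_point[OF cball])
        then have "isCont (closest_point (cball 0 M :: complex set)) (g x)"
          by (simp add: continuous_on_eq_continuous_at)
        then have "(\<lambda>n. hn n x) \<longlonglongrightarrow> closest_point (cball 0 M) (g x)"
          unfolding hn_def using elim by (rule isCont_tendsto_compose)
        moreover have "(\<lambda>n. hn n x - p n x) \<longlonglongrightarrow> 0"
          by (rule Lim_null_comparison[OF always_eventually[OF allI[OF less_imp_le[OF p(2)[OF True]]]]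
                LIMSEQ_inverse_real_of_nat])
        ultimately have "(\<lambda>n. hn n x - (hn n x - p n x)) \<longlonglongrightarrow> closest_point (cball 0 M) (g x) - 0"
          by (rule tendsto_diff)
        then have "(\<lambda>n. c x *\<^sub>R p n x) \<longlonglongrightarrow> c x *\<^sub>R g x"
          using g_bound[of x] by (intro tendsto_intros) (simp add: closest_point_self)
        then show ?thesis by (simp add: cg)
      next
        case False
        then show ?thesis using cg[of x] by (simp add: c_zero)
      qed
    qed
    then show "AE x in half_line. (\<lambda>n. c x *\<^sub>R p n x) \<longlonglongrightarrow> u x"
      unfolding AE_half_line_iff by eventually_elim simp
  qed
  then show ?thesis
    unfolding closure_sequential using bump
    by (intro exI[of _ "\<lambda>n. abs_L2h (\<lambda>x. c x *\<^sub>R p n x)"]) blast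
qed

text \<open>Truncation in both the argument and the value reduces this to bounded functions with compact
  support away from zero.\<close>

lemma closure_bumps: "closure {abs_L2h v |v. bump v} = UNIV"
proof -
  have "f \<in> closure {abs_L2h v |v. bump v}" for f
  proof -
    obtain u where u: "sq_integrable u" "f = abs_L2h u"
      by (rule L2h_cases)
    define un where "un n x = (if x \<in> {inverse (real (Suc n))..real (Suc n)} \<and> norm (u x) \<le> real n then u x else 0)" for n x
    have meas: "un n \<in> borel_measurable half_line" for n
    proof -
      have "(\<lambda>z::complex. if norm z \<le> real n then z else 0) \<in> borel_measurable borel"
        by measurable
      then have "(\<lambda>x. if norm (u x) \<le> real n then u x else 0) \<in> borel_measurable half_line"
        by (rule measurable_compose[OF sq_integrable_borel[OF u(1)]])
      moreover have "(indicator {inverse (real (Suc n))..real (Suc n)} :: real \<Rightarrow> real) \<in> borel_measurable half_line"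
        by (intro measurable_restrict_space1 borel_measurable_indicator) simp
      moreover have "un n = (\<lambda>x. indicator {inverse (real (Suc n))..real (Suc n)} x *\<^sub>R
          (if norm (u x) \<le> real n then u x else 0))"
        by (auto simp: un_def indicator_def fun_eq_iff)
      ultimately show ?thesis by simp
    qed
    have le: "norm (un n x) \<le> norm (u x)" for n x
      by (simp add: un_def)
    have un: "sq_integrable (un n)" for n
      by (rule sq_integrable_bound[OF meas u(1) le])
    have "(\<lambda>n. abs_L2h (un n)) \<longlonglongrightarrow> abs_L2h u"
    proof (rule abs_L2h_tendsto[OF u(1) u(1) un])
      have "AE x in lborel. x \<noteq> (0::real)"
        by (rule AE_lborel_singleton)
      then show "AE x in half_line. (\<lambda>n. un n x) \<longlonglongrightarrow> u x"
        unfolding AE_half_line_iff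
      proof eventually_elim
        case (elim x)
        show ?case
        proof
          assume "0 \<le> x"
          with elim have x: "0 < x" by simp
          obtain n1 where n1: "inverse (real (Suc n1)) < x"
            using reals_Archimedean[OF x] by blast
          obtain n2 where n2: "max x (norm (u x)) < real n2"
            using reals_Archimedean2 by blast
          have "un n x = u x" if n: "max n1 n2 \<le> n" for n
          proof -
            have "inverse (real (Suc n)) \<le> inverse (real (Suc n1))"
              using n by (intro le_imp_inverse_le) auto
            with n1 have "inverse (real (Suc n)) \<le> x" by linarith
            moreover have "real n2 \<le> real n" using n by simp
            then have "x \<le> real (Suc n)" "norm (u x) \<le> real n" using n2 by auto
            ultimately show ?thesis by (simp only: un_def atLeastAtMost_iff simp_thms if_True)
          qed
          then show "(\<lambda>n. un n x) \<longlonglongrightarrow> u x"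
            by (intro tendsto_eventually eventually_sequentiallyI[of "max n1 n2"]) blast
        qed
      qed
    qed (use le in auto)
    moreover have "abs_L2h (un n) \<in> closure {abs_L2h v |v. bump v}" for n
    proof (rule bounded_in_closure_bumps[OF un, of "inverse (real (Suc n))" "real (Suc n)" "real n"])
      have "inverse (real (Suc n)) \<le> 1" by (simp add: inverse_le_1_iff)
      then show "inverse (real (Suc n)) \<le> real (Suc n)" by linarith
    qed (auto simp: un_def)
    ultimately show ?thesis
      unfolding u(2) using closed_closure closed_sequential_limits[THEN iffD1, rule_format,
        of "closure {abs_L2h v |v. bump v}" "\<lambda>n. abs_L2h (un n)" "abs_L2h u"] by blast
  qed
  then show ?thesis by auto
qed

section \<open>Weak derivatives and traces of classical functions\<close>

lemma integrable_scaleR_sq_integrable: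
  assumes "sq_integrable (\<lambda>x. complex_of_real (\<phi> x))" "\<phi> \<in> borel_measurable half_line" "sq_integrable v"
  shows "integrable half_line (\<lambda>x. \<phi> x *\<^sub>R v x)"
proof (rule Bochner_Integration.integrable_bound)
  note [measurable] = assms(2) sq_integrable_borel[OF assms(3)]
  show "integrable half_line (\<lambda>x. (norm (complex_of_real (\<phi> x)))\<^sup>2 + (norm (v x))\<^sup>2)"
    using assms by (auto simp: sq_integrable_def)
  have "norm (\<phi> x *\<^sub>R v x) \<le> norm ((norm (complex_of_real (\<phi> x)))\<^sup>2 + (norm (v x))\<^sup>2)" for x
  proof -
    have "\<bar>\<phi> x\<bar> * norm (v x) \<le> \<bar>\<phi> x\<bar>\<^sup>2 + (norm (v x))\<^sup>2"
      using sum_squares_bound[of "\<bar>\<phi> x\<bar>" "norm (v x)"]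
        mult_nonneg_nonneg[OF abs_ge_zero[of "\<phi> x"] norm_ge_zero[of "v x"]] by linarith
    then show ?thesis by simp
  qed
  then show "AE x in half_line. norm (\<phi> x *\<^sub>R v x) \<le> norm ((norm (complex_of_real (\<phi> x)))\<^sup>2 + (norm (v x))\<^sup>2)"
    by (intro AE_I2)
  show "(\<lambda>x. \<phi> x *\<^sub>R v x) \<in> borel_measurable half_line"
    by measurable
qed

lemma test_function_compose_bump:
  assumes "bump u" and L: "bounded_linear (L :: complex \<Rightarrow> real)"
  shows "test_function (\<lambda>x. L (u x))"
proof -
  obtain u' u'' a b where u: "0 < a"
      "\<And>x. (u has_vector_derivative u' x) (at x)" "\<And>x. (u' has_vector_derivative u'' x) (at x)"
      "\<And>x. x \<notin> {a<..<b} \<Longrightarrow> u x = 0"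
    using assms(1) unfolding bump_def by blast
  have "continuous_on UNIV u'"
    using u(3) by (auto intro!: continuous_at_imp_continuous_on has_vector_derivative_continuous)
  then have "(\<lambda>x. L (u x)) C1_differentiable_on UNIV"
    unfolding C1_differentiable_on_def using u(2)
    by (intro exI[of _ "\<lambda>x. L (u' x)"] conjI ballI bounded_linear.has_vector_derivative[OF L]
        bounded_linear.continuous_on[OF L]) auto
  moreover have "closure {x. L (u x) \<noteq> 0} \<subseteq> {a..b}"
  proof (rule closure_minimal)
    show "{x. L (u x) \<noteq> 0} \<subseteq> {a..b}"
    proof
      fix x assume "x \<in> {x. L (u x) \<noteq> 0}"
      then have "u x \<noteq> 0"
        using linear_0[OF bounded_linear.linear[OF L]] by auto
      then have "x \<in> {a<..<b}" using u(4) by blast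
      then show "x \<in> {a..b}" by simp
    qed
  qed simp
  moreover from this have "compact (closure {x. L (u x) \<noteq> 0})"
    by (metis compact_Icc closed_closure compact_Int_closed inf.absorb_iff2)
  ultimately show ?thesis
    using u(1) by (force simp: test_function_def)
qed

text \<open>The real and imaginary parts of a bump are test functions, so the difference of two weak derivatives is
  orthogonal to all bumps, hence to a dense set.\<close>

lemma has_weak_deriv_unique:
  assumes "has_weak_deriv f g" "has_weak_deriv f g'"
  shows "g = g'"
proof -
  obtain u v v' where uv: "sq_integrable u" "f = abs_L2h u" "sq_integrable v" "g = abs_L2h v"
      "sq_integrable v'" "g' = abs_L2h v'"
    by (metis L2h_cases)
  define d where "d x = v x - v' x" for x
  have d: "sq_integrable d"
    unfolding d_def using uv by (intro sq_integrable_diff)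
  have test: "(LINT x|half_line. \<phi> x *\<^sub>R d x) = 0" "integrable half_line (\<lambda>x. \<phi> x *\<^sub>R d x)"
    if "test_function \<phi>" for \<phi>
  proof -
    from \<open>test_function \<phi>\<close> obtain D a b where \<phi>: "\<And>x. (\<phi> has_real_derivative D x) (at x)" "\<And>x. x \<notin> {a<..<b} \<Longrightarrow> \<phi> x = 0"
      by (metis test_functionE)
    have cont: "continuous_on {0..} \<phi>"
      using \<phi>(1) by (auto intro: DERIV_continuous_on has_field_derivative_at_within)
    then have sq: "sq_integrable (\<lambda>x. complex_of_real (\<phi> x))"
      using \<phi>(2) by (intro decaying_sq_integrable compact_support_decaying[of _ b] continuous_intros) auto
    note int = integrable_scaleR_sq_integrable[OF sq borel_measurable_half_line_continuous[OF cont]]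
    show "integrable half_line (\<lambda>x. \<phi> x *\<^sub>R d x)"
      by (rule int[OF d])
    have "(LINT x|half_line. \<phi> x *\<^sub>R v x) = (LINT x|half_line. \<phi> x *\<^sub>R v' x)"
      using assms uv that by (simp add: has_weak_deriv.abs_eq ae_eq_refl_iff)
    then show "(LINT x|half_line. \<phi> x *\<^sub>R d x) = 0"
      unfolding d_def using int[OF uv(3)] int[OF uv(5)] by (simp add: scaleR_diff_right)
  qed
  have "abs_L2h d \<bullet> abs_L2h w = 0" if "bump w" for w
  proof -
    have w: "sq_integrable w"
    proof -
      obtain w' a b where "\<And>x. (w has_vector_derivative w' x) (at x)" "\<And>x. x \<notin> {a<..<b} \<Longrightarrow> w x = 0"
        using \<open>bump w\<close> unfolding bump_def by blast
      then show ?thesis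
        by (intro decaying_sq_integrable compact_support_decaying[of _ b] continuous_at_imp_continuous_on
            ballI has_vector_derivative_continuous) auto
    qed
    note re = test[OF test_function_compose_bump[OF that bounded_linear_Re]]
    note im = test[OF test_function_compose_bump[OF that bounded_linear_Im]]
    have "abs_L2h d \<bullet> abs_L2h w = (LINT x|half_line. Re (Re (w x) *\<^sub>R d x) + Im (Im (w x) *\<^sub>R d x))"
      by (simp add: inner_abs_L2h d w inner_complex_def mult.commute)
    also have "\<dots> = (LINT x|half_line. Re (Re (w x) *\<^sub>R d x)) + (LINT x|half_line. Im (Im (w x) *\<^sub>R d x))"
      using re(2) im(2) by (intro Bochner_Integration.integral_add integrable_Re integrable_Im)
    also have "\<dots> = 0"
      using re im by (simp only: integral_Re integral_Im) simp
    finally show ?thesis .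
  qed
  then have "{abs_L2h w |w. bump w} \<subseteq> {h. abs_L2h d \<bullet> h = 0}"
    by auto
  then have "closure {abs_L2h w |w. bump w} \<subseteq> {h. abs_L2h d \<bullet> h = 0}"
    by (intro closure_minimal closed_Collect_eq continuous_intros)
  then have "abs_L2h d \<bullet> abs_L2h d = 0"
    unfolding closure_bumps by blast
  then have "abs_L2h d = 0"
    by simp
  then show ?thesis
    using uv unfolding d_def by (simp flip: abs_L2h_diff)
qed

lemma weak_deriv_eq: "has_weak_deriv f g \<Longrightarrow> weak_deriv f = g"
  unfolding weak_deriv_def using has_weak_deriv_unique by (intro the_equality) auto

text \<open>Classical elements of the second Sobolev space, for which weak derivatives and traces
  are the ordinary ones.\<close>

definition C2_decaying :: "(real \<Rightarrow> complex) \<Rightarrow> (real \<Rightarrow> complex) \<Rightarrow> (real \<Rightarrow> complex) \<Rightarrow> bool"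
  where "C2_decaying u u' u'' \<longleftrightarrow> decaying u \<and> decaying u' \<and> decaying u'' \<and>
    (\<forall>x>0. (u has_vector_derivative u' x) (at x) \<and> (u' has_vector_derivative u'' x) (at x))"

lemma C2_decaying_H2:
  assumes "C2_decaying u u' u''"
  shows "abs_L2h u \<in> H2" "weak_deriv (abs_L2h u) = abs_L2h u'"
    "weak_deriv (abs_L2h u') = abs_L2h u''"
    "at_zero (abs_L2h u) = u 0" "at_zero (abs_L2h u') = u' 0"
proof -
  have w: "has_weak_deriv (abs_L2h u) (abs_L2h u')" "has_weak_deriv (abs_L2h u') (abs_L2h u'')"
    using assms by (auto simp: C2_decaying_def intro: has_weak_deriv_of_derivative)
  then show "abs_L2h u \<in> H2" "weak_deriv (abs_L2h u) = abs_L2h u'" "weak_deriv (abs_L2h u') = abs_L2h u''"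
    by (auto simp: H2_def weak_deriv_eq)
  show "at_zero (abs_L2h u) = u 0" "at_zero (abs_L2h u') = u' 0"
    using assms by (auto simp: C2_decaying_def intro!: at_zero_abs_L2h decaying_continuous decaying_sq_integrable)
qed

lemma C2_decaying_laplacian:
  assumes "C2_decaying u1 u1' u1''" "C2_decaying u2 u2' u2''"
  shows "((abs_L2h u1, abs_L2h u2), \<eta>) \<in> laplacian A B \<longleftrightarrow>
    \<eta> = (abs_L2h u1'', abs_L2h u2'') \<and>
    A *v vector [u1 0, u2 0] + B *v vector [u1' 0, u2' 0] = 0"
  using C2_decaying_H2[OF assms(1)] C2_decaying_H2[OF assms(2)]
  by (auto simp: laplacian_def laplacian_dom_def)

lemma C2_decaying_add:
  assumes "C2_decaying u u' u''" "C2_decaying v v' v''"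
  shows "C2_decaying (\<lambda>x. u x + v x) (\<lambda>x. u' x + v' x) (\<lambda>x. u'' x + v'' x)"
  using assms by (auto simp: C2_decaying_def intro!: decaying_add has_vector_derivative_add)

lemma C2_decaying_exp:
  assumes "0 < c"
  shows "C2_decaying (\<lambda>x. a * of_real (exp (- c * x))) (\<lambda>x. - c * a * of_real (exp (- c * x)))
    (\<lambda>x. c\<^sup>2 * a * of_real (exp (- c * x)))"
proof -
  have deriv: "((\<lambda>x. z * complex_of_real (exp (- c * x))) has_vector_derivative - c * z * of_real (exp (- c * x))) (at x)" for z :: complex and x
  proof -
    have "((\<lambda>x. exp (- c * x)) has_real_derivative - c * exp (- c * x)) (at x)"
      by (auto intro!: derivative_eq_intros)
    then have "((\<lambda>x. z * of_real (exp (- c * x))) has_vector_derivative z * of_real (- c * exp (- c * x))) (at x)"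
      by (intro has_vector_derivative_mult_right has_vector_derivative_of_real)
    then show ?thesis by (simp add: mult_ac)
  qed
  have "((\<lambda>x. - c * a * of_real (exp (- c * x))) has_vector_derivative c\<^sup>2 * a * of_real (exp (- c * x))) (at x)" for x
    using deriv[of "- c * a" x] by (simp add: power2_eq_square mult_ac)
  then show ?thesis
    unfolding C2_decaying_def using deriv[of a]
    by (intro conjI allI impI decaying_exp[OF assms]) auto
qed

lemma bump_C2_decaying:
  assumes "bump u"
  obtains u' u'' where "C2_decaying u u' u''" "u 0 = 0" "u' 0 = 0"
proof -
  obtain u' u'' a b where u: "0 < a" "continuous_on UNIV u''"
      "\<And>x. (u has_vector_derivative u' x) (at x)" "\<And>x. (u' has_vector_derivative u'' x) (at x)"
      "\<And>x. x \<notin> {a<..<b} \<Longrightarrow> u x = 0 \<and> u' x = 0 \<and> u'' x = 0"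
    using assms unfolding bump_def by blast
  have "continuous_on {0..} u" "continuous_on {0..} u'" "continuous_on {0..} u''"
    using u(3,4) continuous_on_subset[OF u(2)]
    by (auto intro: continuous_at_imp_continuous_on has_vector_derivative_continuous)
  then have "decaying u" "decaying u'" "decaying u''"
    using u(5) by (auto intro!: compact_support_decaying[of _ b])
  then have "C2_decaying u u' u''"
    using u by (auto simp: C2_decaying_def)
  then show thesis
    using u(1) u(5)[of 0] by (intro that[of u' u'']) auto
qed

lemma vector2_zero: "vector [0, 0] = (0 :: complex^2)"
  by (simp add: vec_eq_iff forall_2)

lemma closure_domain_laplacian: "closure (Domain (laplacian A B)) = UNIV"
proof -
  let ?D = "{abs_L2h v |v. bump v}"
  have "?D \<times> ?D \<subseteq> Domain (laplacian A B)"
  proof clarify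
    fix u1 u2 assume "bump u1" "bump u2"
    then obtain u1' u1'' u2' u2'' where
      "C2_decaying u1 u1' u1''" "u1 0 = 0" "u1' 0 = 0" "C2_decaying u2 u2' u2''" "u2 0 = 0" "u2' 0 = 0"
      by (metis bump_C2_decaying)
    then have "((abs_L2h u1, abs_L2h u2), (abs_L2h u1'', abs_L2h u2'')) \<in> laplacian A B"
      by (simp add: C2_decaying_laplacian vector2_zero)
    then show "(abs_L2h u1, abs_L2h u2) \<in> Domain (laplacian A B)" by blast
  qed
  then have "closure (?D \<times> ?D) \<subseteq> closure (Domain (laplacian A B))"
    by (rule closure_mono)
  then show ?thesis
    unfolding closure_Times closure_bumps by auto
qed

section \<open>Functions with values in a closed set\<close>

text \<open>A common generalisation of \<^const>\<open>real_valued\<close> and \<^const>\<open>nonneg_valued\<close>, so that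
  realness and positivity are two instances of one argument.\<close>

lift_definition values_in :: "complex set \<Rightarrow> L2h \<Rightarrow> bool" is "\<lambda>C f. AE x in half_line. f x \<in> C"
proof -
  fix C f g assume "ae_eq f g"
  then have "AE x in half_line. f x = g x" by (simp add: ae_eq_def)
  then have "AE x in half_line. (f x \<in> C) = (g x \<in> C)" by eventually_elim simp
  then show "(AE x in half_line. f x \<in> C) = (AE x in half_line. g x \<in> C)"
    by (rule eventually_subst)
qed

lemma values_in_abs_L2h: "sq_integrable u \<Longrightarrow> values_in C (abs_L2h u) \<longleftrightarrow> (AE x in half_line. u x \<in> C)"
  by (simp add: values_in.abs_eq ae_eq_refl_iff)

lemma real_valued_eq_values_in: "real_valued = values_in \<real>"
  by (rule ext, transfer) simp

lemma nonneg_valued_eq_values_in: "nonneg_valued = values_in \<real>\<^sub>\<ge>\<^sub>0"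
  by (rule ext, transfer) simp

text \<open>If \<open>v\<close> takes values in \<open>C\<close>, the pointwise distance of \<open>u\<close> to \<open>C\<close> is at most \<open>norm (u - v)\<close>. In the limit
  the integral of its square over the half line vanishes.\<close>

lemma closed_values_in:
  assumes C: "closed C" "0 \<in> C"
  shows "closed {f. values_in C f}"
  unfolding closed_sequential_limits
proof (intro allI impI, elim conjE)
  fix fn f assume fn: "\<forall>n. fn n \<in> {f. values_in C f}" "fn \<longlonglongrightarrow> f"
  obtain u where u: "sq_integrable u" "f = abs_L2h u"
    by (rule L2h_cases)
  note [measurable] = sq_integrable_borel[OF u(1)]
  define d where "d x = (infdist (u x) C)\<^sup>2" for x
  have "(\<lambda>z. infdist z C) \<in> borel_measurable borel"
    by (intro borel_measurable_continuous_onI continuous_on_infdist continuous_on_id)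
  then have meas: "d \<in> borel_measurable half_line"
    unfolding d_def by (intro borel_measurable_power measurable_compose[OF sq_integrable_borel[OF u(1)]])
  have int: "integrable half_line d"
  proof (rule Bochner_Integration.integrable_bound[OF _ meas])
    show "integrable half_line (\<lambda>x. (norm (u x))\<^sup>2)" using u by (simp add: sq_integrable_def)
    have "(infdist (u x) C)\<^sup>2 \<le> (norm (u x))\<^sup>2" for x
      using infdist_le[OF C(2), of "u x"] by (intro power_mono infdist_nonneg) simp
    then show "AE x in half_line. norm (d x) \<le> norm ((norm (u x))\<^sup>2)"
      by (intro AE_I2) (simp add: d_def)
  qed
  have le: "(LINT x|half_line. d x) \<le> (norm (fn n - f))\<^sup>2" for n
  proof -
    obtain v where v: "sq_integrable v" "fn n = abs_L2h v"
      by (rule L2h_cases)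
    have "AE x in half_line. v x \<in> C"
      using fn(1) v by (metis mem_Collect_eq values_in_abs_L2h)
    then have "AE x in half_line. d x \<le> (norm (v x - u x))\<^sup>2"
    proof eventually_elim
      case (elim x)
      then show ?case
        using infdist_le[of "v x" C "u x"] unfolding d_def
        by (intro power_mono infdist_nonneg) (simp add: dist_norm norm_minus_commute)
    qed
    then have "(LINT x|half_line. d x) \<le> (LINT x|half_line. (norm (v x - u x))\<^sup>2)"
      using sq_integrable_diff[OF v(1) u(1)] by (intro integral_mono_AE int) (simp_all add: sq_integrable_def)
    then show ?thesis
      by (simp add: u v norm_diff_abs_L2h)
  qed
  have "(\<lambda>n. (norm (fn n - f))\<^sup>2) \<longlonglongrightarrow> (norm (f - f))\<^sup>2"
    using fn(2) by (intro tendsto_intros)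
  then have "(LINT x|half_line. d x) \<le> 0"
    using le by (intro LIMSEQ_le_const[of "\<lambda>n. (norm (fn n - f))\<^sup>2"]) auto
  moreover have "0 \<le> (LINT x|half_line. d x)"
    by (simp add: d_def)
  ultimately have "(LINT x|half_line. d x) = 0"
    by (rule antisym)
  then have "AE x in half_line. d x = 0"
    by (subst (asm) integral_nonneg_eq_0_iff_AE[OF int]) (simp_all add: d_def)
  then have "AE x in half_line. u x \<in> C"
  proof eventually_elim
    case (elim x)
    then show ?case
      using C in_closed_iff_infdist_zero[of C "u x"] by (auto simp: d_def)
  qed
  then show "f \<in> {f. values_in C f}"
    by (simp add: u values_in_abs_L2h)
qed

definition compactly_supported_in :: "complex set \<Rightarrow> (real \<Rightarrow> complex) \<Rightarrow> bool"
  where "compactly_supported_in C k \<longleftrightarrow> continuous_on {0..} k \<and> (\<exists>R. \<forall>x>R. k x = 0) \<and> (\<forall>x. k x \<in> C)"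

lemma compactly_supported_in_decaying: "compactly_supported_in C k \<Longrightarrow> decaying k"
  by (auto simp: compactly_supported_in_def intro: compact_support_decaying)

text \<open>Approximate by bumps and project the approximants pointwise onto \<open>C\<close>. The nearest point
  projection is nonexpansive and fixes \<open>C\<close>, so the approximation does not get worse; it also fixes
  zero, so supports stay compact. Smoothness is lost but continuity is kept.\<close>

lemma values_in_subset_closure:
  assumes C: "closed C" "convex C" "0 \<in> C"
  shows "{f. values_in C f} \<subseteq> closure {abs_L2h k |k. compactly_supported_in C k}"
proof clarify
  fix f assume f: "values_in C f"
  obtain u where u: "sq_integrable u" "f = abs_L2h u"
    by (rule L2h_cases)
  have ne: "C \<noteq> {}" using C(3) by auto
  have "f \<in> closure {abs_L2h v |v. bump v}" by (simp add: closure_bumps)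
  then obtain vn where "\<And>n. vn n \<in> {abs_L2h v |v. bump v}" "vn \<longlonglongrightarrow> f"
    unfolding closure_sequential by blast
  then obtain v where v: "\<And>n. bump (v n)" "(\<lambda>n. abs_L2h (v n)) \<longlonglongrightarrow> f"
  proof -
    have "\<exists>v. \<forall>n. bump (v n) \<and> vn n = abs_L2h (v n)"
      using \<open>\<And>n. vn n \<in> {abs_L2h v |v. bump v}\<close> by (intro choice) blast
    then show thesis using \<open>vn \<longlonglongrightarrow> f\<close> that by (metis (no_types, lifting) ext)
  qed
  define k where "k n x = closest_point C (v n x)" for n x
  have k: "compactly_supported_in C (k n)" for n
  proof -
    obtain w' a b where w: "\<And>x. (v n has_vector_derivative w' x) (at x)" "\<And>x. x \<notin> {a<..<b} \<Longrightarrow> v n x = 0"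
      using v(1)[of n] unfolding bump_def by blast
    have "continuous_on {0..} (v n)"
      using w(1) by (auto intro!: continuous_at_imp_continuous_on has_vector_derivative_continuous)
    then have "continuous_on {0..} (k n)"
      unfolding k_def
      by (rule continuous_on_compose2[OF continuous_on_closest_point[OF C(2,1) ne, of UNIV]]) auto
    moreover have "k n x = 0" if "b < x" for x
      using w(2)[of x] that C(3) by (simp add: k_def closest_point_self)
    moreover have "k n x \<in> C" for x
      unfolding k_def by (rule closest_point_in_set[OF C(1) ne])
    ultimately show ?thesis by (auto simp: compactly_supported_in_def)
  qed
  have sq: "sq_integrable (v n)" "sq_integrable (k n)" for n
    using bump_C2_decaying[OF v(1)[of n]] compactly_supported_in_decaying[OF k[of n]]
    by (metis C2_decaying_def decaying_sq_integrable)+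
  have le: "norm (abs_L2h (k n) - f) \<le> norm (abs_L2h (v n) - f)" for n
  proof -
    have "AE x in half_line. u x \<in> C"
      using f u by (simp add: values_in_abs_L2h)
    then have "AE x in half_line. norm (k n x - u x) \<le> norm (v n x - u x)"
    proof eventually_elim
      case (elim x)
      then show ?case
        using closest_point_lipschitz[OF C(2,1) ne, of "v n x" "u x"]
        by (simp add: k_def closest_point_self dist_norm)
    qed
    then show ?thesis
      unfolding u(2) using sq[of n] u(1) by (simp add: abs_L2h_diff norm_abs_L2h_mono sq_integrable_diff)
  qed
  have "(\<lambda>n. abs_L2h (v n) - f) \<longlonglongrightarrow> 0"
    using v(2) by (simp add: LIM_zero_iff)
  then have "(\<lambda>n. abs_L2h (k n) - f) \<longlonglongrightarrow> 0"
    by (rule Lim_null_comparison[OF always_eventually[OF allI[OF le]] tendsto_norm_zero])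
  then have "(\<lambda>n. abs_L2h (k n)) \<longlonglongrightarrow> f"
    by (simp add: LIM_zero_iff)
  then show "f \<in> closure {abs_L2h k |k. compactly_supported_in C k}"
    unfolding closure_sequential using k by (intro exI[of _ "\<lambda>n. abs_L2h (k n)"]) blast
qed

section \<open>The resolvent on the half line\<close>

text \<open>Extending \<open>f\<close> by its value at zero to the left yields an antiderivative that is two-sided
  differentiable at zero.\<close>

lemma half_line_antiderivative:
  fixes f :: "real \<Rightarrow> real"
  assumes "continuous_on {0..} f"
  obtains F where "F 0 = 0" "\<And>x. 0 \<le> x \<Longrightarrow> (F has_real_derivative f x) (at x)"
proof -
  define g where "g x = f (max 0 x)" for x
  have g: "continuous_on S g" for S
    unfolding g_def by (rule continuous_on_compose2[OF assms]) (auto intro!: continuous_intros)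
  define F where "F x = integral {-1..x} g - integral {-1..0} g" for x
  have "(F has_real_derivative f x) (at x)" if "0 \<le> x" for x
  proof -
    have "((\<lambda>u. integral {-1..u} g) has_real_derivative g x) (at x within {-1..x + 1})"
      by (rule integral_has_real_derivative[OF g]) (use that in auto)
    then have "((\<lambda>u. integral {-1..u} g) has_real_derivative g x) (at x)"
      using that by (simp add: at_within_Icc_at)
    then show ?thesis
      unfolding F_def using that by (auto intro!: derivative_eq_intros simp: g_def)
  qed
  then show thesis by (intro that[of F]) (simp_all add: F_def)
qed

text \<open>The solution of \<open>\<kappa>\<^sup>2 * v - v'' = \<kappa>\<^sup>2 * k\<close> with \<open>v 0 = 0\<close>, by variation of constants: its
  Green function is \<open>\<kappa> * exp (- \<kappa> * max x y) * sinh (\<kappa> * min x y)\<close>, which is nonnegative. Beyond the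
  support of \<open>k\<close> the solution is a multiple of \<open>exp (- \<kappa> * x)\<close>.\<close>

lemma dirichlet_resolvent:
  fixes k :: "real \<Rightarrow> real"
  assumes \<kappa>: "0 < \<kappa>" and k: "continuous_on {0..} k" "\<And>x. R < x \<Longrightarrow> k x = 0"
  obtains v v' :: "real \<Rightarrow> real" where
    "C2_decaying (\<lambda>x. of_real (v x)) (\<lambda>x. of_real (v' x)) (\<lambda>x. of_real (\<kappa>\<^sup>2 * (v x - k x)))"
    "v 0 = 0" "(\<And>x. 0 \<le> x \<Longrightarrow> 0 \<le> k x) \<Longrightarrow> 0 \<le> v' 0"
    "\<And>x. (\<And>x. 0 \<le> x \<Longrightarrow> 0 \<le> k x) \<Longrightarrow> 0 \<le> x \<Longrightarrow> 0 \<le> v x"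
proof -
  obtain P where P: "P 0 = 0" "\<And>x. 0 \<le> x \<Longrightarrow> (P has_real_derivative sinh (\<kappa> * x) * k x) (at x)"
    by (rule half_line_antiderivative[of "\<lambda>x. sinh (\<kappa> * x) * k x"])
      (use k in \<open>auto intro!: continuous_intros\<close>)
  obtain E where E: "\<And>x. 0 \<le> x \<Longrightarrow> (E has_real_derivative exp (- \<kappa> * x) * k x) (at x)"
    by (rule half_line_antiderivative[of "\<lambda>x. exp (- \<kappa> * x) * k x"])
      (use k in \<open>auto intro!: continuous_intros\<close>)
  \<comment> \<open>beyond \<open>R\<close>, so that \<open>k\<close> vanishes at \<open>r\<close> itself\<close>
  define r where "r = max 0 R + 1"
  have r: "0 \<le> r" "\<And>x. r \<le> x \<Longrightarrow> k x = 0"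
    using k(2) by (auto simp: r_def)
  \<comment> \<open>this is the integral of \<open>exp (- \<kappa> * y) * k y\<close> over all \<open>y\<close> from \<open>x\<close> on\<close>
  define Q where "Q x = E r - E x" for x
  have Q: "(Q has_real_derivative - (exp (- \<kappa> * x) * k x)) (at x)" if "0 \<le> x" for x
    unfolding Q_def using E[OF that] by (auto intro!: derivative_eq_intros)
  have const: "F x = F r" if "r \<le> x" "\<And>x. 0 \<le> x \<Longrightarrow> (F has_real_derivative c x * k x) (at x)" for F c x
  proof (rule antisym)
    have "(F has_real_derivative 0) (at y)" if "r \<le> y" for y
      using that \<open>\<And>x. 0 \<le> x \<Longrightarrow> (F has_real_derivative c x * k x) (at x)\<close>[of y] r by auto
    then show "F x \<le> F r" "F r \<le> F x"
      using that(1) DERIV_nonpos_imp_nonincreasing[of r x F] DERIV_nonneg_imp_nondecreasing[of r x F]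
      by (meson order_refl)+
  qed
  have P_far: "P x = P r" and Q_far: "Q x = 0" if "r \<le> x" for x
    using const[OF that P(2)] const[OF that E] by (auto simp: Q_def)
  define v where "v x = \<kappa> * (exp (- \<kappa> * x) * P x + sinh (\<kappa> * x) * Q x)" for x
  define v' where "v' x = \<kappa>\<^sup>2 * (cosh (\<kappa> * x) * Q x - exp (- \<kappa> * x) * P x)" for x
  have v: "(v has_real_derivative v' x) (at x)" if "0 \<le> x" for x
    unfolding v_def v'_def using P(2)[OF that] Q[OF that]
    by (auto intro!: derivative_eq_intros simp: power2_eq_square algebra_simps)
  have v': "(v' has_real_derivative \<kappa>\<^sup>2 * (v x - k x)) (at x)" if "0 \<le> x" for x
  proof -
    have "(v' has_real_derivative \<kappa>\<^sup>2 * ((sinh (\<kappa> * x) * \<kappa> * Q x + - (exp (- \<kappa> * x) * k x) * cosh (\<kappa> * x))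
        - (exp (- \<kappa> * x) * (- \<kappa>) * P x + sinh (\<kappa> * x) * k x * exp (- \<kappa> * x)))) (at x)"
      unfolding v'_def using P(2)[OF that] Q[OF that] by (auto intro!: derivative_eq_intros)
    moreover have "exp (- \<kappa> * x) * cosh (\<kappa> * x) + sinh (\<kappa> * x) * exp (- \<kappa> * x) = 1"
      by (simp add: mult.commute[of "sinh _"] flip: distrib_left)
        (simp add: cosh_plus_sinh flip: exp_add)
    then have "\<kappa>\<^sup>2 * ((sinh (\<kappa> * x) * \<kappa> * Q x + - (exp (- \<kappa> * x) * k x) * cosh (\<kappa> * x))
        - (exp (- \<kappa> * x) * (- \<kappa>) * P x + sinh (\<kappa> * x) * k x * exp (- \<kappa> * x))) = \<kappa>\<^sup>2 * (v x - k x)"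
      unfolding v_def by algebra
    ultimately show ?thesis
      by (simp only:)
  qed
  have cont: "continuous_on {0..} v" "continuous_on {0..} v'"
    by (rule DERIV_continuous_on, rule has_field_derivative_at_within, (rule v v'), simp)+
  have decay_v: "decaying (\<lambda>x. complex_of_real (v x))"
  proof (rule decayingI[OF _ \<kappa>])
    show "continuous_on {0..} (\<lambda>x. complex_of_real (v x))"
      by (intro continuous_intros cont)
    show "norm (complex_of_real (v x)) \<le> \<bar>\<kappa> * P r\<bar> * exp (- \<kappa> * x)" if "r \<le> x" for x
      unfolding v_def P_far[OF that] Q_far[OF that] norm_of_real by (simp add: abs_mult)
  qed
  have decay_v': "decaying (\<lambda>x. complex_of_real (v' x))"
  proof (rule decayingI[OF _ \<kappa>])
    show "continuous_on {0..} (\<lambda>x. complex_of_real (v' x))"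
      by (intro continuous_intros cont)
    show "norm (complex_of_real (v' x)) \<le> \<bar>\<kappa>\<^sup>2 * P r\<bar> * exp (- \<kappa> * x)" if "r \<le> x" for x
      unfolding v'_def P_far[OF that] Q_far[OF that] norm_of_real by (simp add: abs_mult)
  qed
  have "decaying (\<lambda>x. complex_of_real (k x))"
    using k by (intro compact_support_decaying[of _ R] continuous_intros) auto
  then have decay_v'': "decaying (\<lambda>x. complex_of_real (\<kappa>\<^sup>2 * (v x - k x)))"
    using decaying_add[OF decaying_mult_left[OF decay_v, of "\<kappa>\<^sup>2"] decaying_mult_left[of _ "- (\<kappa>\<^sup>2)"]]
    by (simp add: algebra_simps)
  show thesis
  proof (rule that[of v v'])
    show "C2_decaying (\<lambda>x. complex_of_real (v x)) (\<lambda>x. complex_of_real (v' x)) (\<lambda>x. complex_of_real (\<kappa>\<^sup>2 * (v x - k x)))"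
      unfolding C2_decaying_def using decay_v decay_v' decay_v'' v v'
      by (auto intro!: has_vector_derivative_of_real simp del: of_real_mult of_real_diff)
    show "v 0 = 0" by (simp add: v_def P(1))
    assume nonneg: "\<And>x. 0 \<le> x \<Longrightarrow> 0 \<le> k x"
    have P_nonneg: "0 \<le> P x" if "0 \<le> x" for x
    proof -
      have "P 0 \<le> P x"
      proof (rule DERIV_nonneg_imp_nondecreasing[OF that])
        fix y :: real assume "0 \<le> y"
        then show "\<exists>d. (P has_real_derivative d) (at y) \<and> 0 \<le> d"
          using P(2)[of y] nonneg[of y] \<kappa> by (intro exI[of _ "sinh (\<kappa> * y) * k y"]) simp
      qed
      then show ?thesis by (simp add: P(1))
    qed
    have Q_nonneg: "0 \<le> Q x" if "0 \<le> x" for x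
    proof (cases "x \<le> r")
      case True
      have "E x \<le> E r"
      proof (rule DERIV_nonneg_imp_nondecreasing[OF True])
        fix y :: real assume "x \<le> y"
        with that have "0 \<le> y" by simp
        then show "\<exists>d. (E has_real_derivative d) (at y) \<and> 0 \<le> d"
          using E[of y] nonneg[of y] by (intro exI[of _ "exp (- \<kappa> * y) * k y"]) simp
      qed
      then show ?thesis by (simp add: Q_def)
    qed (simp add: Q_far)
    show "0 \<le> v' 0"
      using Q_nonneg[of 0] by (simp add: v'_def P(1))
    show "0 \<le> v x" if "0 \<le> x" for x
      using P_nonneg[OF that] Q_nonneg[OF that] that \<kappa> unfolding v_def
      by (intro mult_nonneg_nonneg add_nonneg_nonneg) auto
  qed
qed

section \<open>Boundary conditions and the Cayley transform\<close>

lemma map_matrix_times_vec: "map_matrix ((*) c) B *v x = c *s (B *v (x :: complex^'n))"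
  for B :: "complex^'n^'m"
  by (simp add: vec_eq_iff matrix_vector_mult_def sum_distrib_left mult.assoc)

lemma minus_matrix_vector_mult: "(- M) *v x = - (M *v x)" for M :: "complex^'n^'m"
  by (simp add: vec_eq_iff matrix_vector_mult_def sum_negf)

lemma matrix_inv_inverse:
  assumes "invertible M"
  shows "M ** matrix_inv M = mat 1" "matrix_inv M ** M = mat 1"
  using someI_ex[OF assms[unfolded invertible_def]] by (auto simp: matrix_inv_def)

lemma bc_pencil_imaginary:
  "bc_pencil (\<i> * complex_of_real \<kappa>) A B = A - map_matrix ((*) (complex_of_real \<kappa>)) B"
  by (simp add: bc_pencil_def vec_eq_iff flip: mult.assoc)

text \<open>The Cayley transform parametrises the boundary condition. The pair of traces \<open>v + w\<close> and
  \<open>\<kappa> * (v - w)\<close> belongs to \<open>v * exp (\<kappa> * x) + w * exp (- \<kappa> * x)\<close>, and the transform maps the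
  coefficients of the growing exponential to those of the decaying one. For
  nonzero \<open>\<kappa>\<close> every pair of traces has this form.\<close>

lemma boundary_condition_iff_cayley:
  assumes inv: "invertible (A - map_matrix ((*) (complex_of_real \<kappa>)) B)"
  shows "A *v (v + w) + B *v (complex_of_real \<kappa> *s (v - w)) = 0 \<longleftrightarrow>
    w = cayley (\<i> * complex_of_real \<kappa>) A B *v v"
proof -
  define M where "M = A - map_matrix ((*) (complex_of_real \<kappa>)) B"
  define N where "N = A + map_matrix ((*) (complex_of_real \<kappa>)) B"
  have "A - map_matrix ((*) (\<i> * (\<i> * complex_of_real \<kappa>))) B = N"
    by (simp add: N_def vec_eq_iff flip: mult.assoc)
  then have S: "cayley (\<i> * complex_of_real \<kappa>) A B *v v = - (matrix_inv M *v (N *v v))"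
    by (simp add: cayley_def bc_pencil_imaginary M_def[symmetric] matrix_vector_mul_assoc
        minus_matrix_vector_mult)
  have "A *v (v + w) + B *v (complex_of_real \<kappa> *s (v - w)) = N *v v + M *v w"
    by (simp add: M_def N_def matrix_vector_mult_add_rdistrib matrix_vector_mult_diff_rdistrib
        matrix_vector_right_distrib matrix_vector_mult_diff_distrib vector_scalar_commute map_matrix_times_vec
        vector_ssub_ldistrib)
  moreover have "N *v v + M *v w = 0 \<longleftrightarrow> w = - (matrix_inv M *v (N *v v))"
  proof
    assume "N *v v + M *v w = 0"
    then have "M *v w = - (N *v v)" by (simp add: eq_neg_iff_add_eq_0 add.commute)
    then have "matrix_inv M *v (M *v w) = - (matrix_inv M *v (N *v v))"
      by (simp add: linear_neg)
    then show "w = - (matrix_inv M *v (N *v v))"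
      using matrix_inv_inverse(2)[of M] inv by (simp add: M_def matrix_vector_mul_assoc)
  next
    assume "w = - (matrix_inv M *v (N *v v))"
    then have "M *v w = - (M *v (matrix_inv M *v (N *v v)))"
      by (simp add: linear_neg)
    also have "\<dots> = - (N *v v)"
      using matrix_inv_inverse(1)[of M] inv by (simp add: M_def matrix_vector_mul_assoc matrix_mul_assoc)
    finally show "N *v v + M *v w = 0" by simp
  qed
  ultimately show ?thesis by (simp add: S)
qed

text \<open>The determinant of \<open>A + z * B\<close> is a polynomial in \<open>z\<close>, nonzero by regularity, so its roots
  are bounded.\<close>

lemma regular_bc_eventually_invertible:
  assumes "regular_bc A B"
  obtains \<kappa>\<^sub>1 :: real where "0 < \<kappa>\<^sub>1"
    "\<And>\<kappa>. \<kappa>\<^sub>1 \<le> \<kappa> \<Longrightarrow> invertible (A - map_matrix ((*) (complex_of_real \<kappa>)) B)"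
proof -
  define p :: "complex poly" where "p = [:A$1$1, B$1$1:] * [:A$2$2, B$2$2:] - [:A$1$2, B$1$2:] * [:A$2$1, B$2$1:]"
  have p: "poly p z = det (A + map_matrix ((*) z) B)" for z
    by (simp add: p_def det_2 algebra_simps)
  from assms obtain k where "invertible (bc_pencil k A B)"
    by (auto simp: regular_bc_def)
  then have "poly p (\<i> * k) \<noteq> 0"
    by (simp add: p invertible_det_nz bc_pencil_def)
  then have "p \<noteq> 0" by auto
  then have "finite {z. poly p z = 0}" by (rule poly_roots_finite)
  then have "bounded {z. poly p z = 0}" by (rule finite_imp_bounded)
  then obtain b where b: "\<And>z. poly p z = 0 \<Longrightarrow> norm z \<le> b"
    by (auto simp: bounded_iff)
  show thesis
  proof (rule that[of "\<bar>b\<bar> + 1"])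
    fix \<kappa> assume \<kappa>: "\<bar>b\<bar> + 1 \<le> \<kappa>"
    then have "poly p (- complex_of_real \<kappa>) \<noteq> 0"
      using b[of "- complex_of_real \<kappa>"] by auto
    moreover have "A + map_matrix ((*) (- complex_of_real \<kappa>)) B = A - map_matrix ((*) (complex_of_real \<kappa>)) B"
      by (simp add: vec_eq_iff)
    ultimately show "invertible (A - map_matrix ((*) (complex_of_real \<kappa>)) B)"
      by (simp add: p invertible_det_nz)
  qed simp
qed

lemma vector2_eta: "vector [a $ 1, a $ 2] = (a :: complex^2)"
  by (simp add: vec_eq_iff forall_2)

text \<open>The resolvent equation is solved by the Dirichlet solutions \<open>v j\<close> plus \<open>a j * exp (- \<kappa> * x)\<close>. With
  \<open>g = v' 0 / (2 * \<kappa>)\<close>, the choice \<open>a = g + S g\<close>, where \<open>S\<close> is the Cayley transform at \<open>\<i> * \<kappa>\<close>, gives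
  the traces \<open>g + S g\<close> and \<open>\<kappa> * (g - S g)\<close>, which satisfy the boundary condition. The Dirichlet part
  and \<open>g\<close> are real for real data and nonnegative for nonnegative data, so invariance of \<open>C\<close>
  under the resolvent comes down to its invariance under \<open>1 + S\<close>.\<close>

lemma laplacian_resolvent:
  assumes \<kappa>: "0 < \<kappa>" and inv: "invertible (A - map_matrix ((*) (complex_of_real \<kappa>)) B)"
    and C: "C = \<real> \<or> C = \<real>\<^sub>\<ge>\<^sub>0"
    and S: "\<And>\<xi>. (\<forall>i. \<xi> $ i \<in> C) \<Longrightarrow> (\<forall>i. ((mat 1 + cayley (\<i> * complex_of_real \<kappa>) A B) *v \<xi>) $ i \<in> C)"
    and k: "\<And>j. compactly_supported_in C (k j)"
  shows "\<exists>w \<eta>. (w, \<eta>) \<in> laplacian A B \<and> values_in C (fst w) \<and> values_in C (snd w) \<and>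
    w - (1 / \<kappa>\<^sup>2) *\<^sub>R \<eta> = (abs_L2h (k 1), abs_L2h (k (2 :: 2)))"
proof -
  let ?S = "cayley (\<i> * complex_of_real \<kappa>) A B"
  have k_real: "complex_of_real (Re (k j x)) = k j x" and k_nonneg: "C = \<real>\<^sub>\<ge>\<^sub>0 \<Longrightarrow> 0 \<le> Re (k j x)" for j x
  proof -
    have "k j x \<in> C" using k[of j] by (auto simp: compactly_supported_in_def)
    then show "complex_of_real (Re (k j x)) = k j x" "C = \<real>\<^sub>\<ge>\<^sub>0 \<Longrightarrow> 0 \<le> Re (k j x)"
      using C by (auto simp: complex_nonneg_Reals_iff complex_is_Real_iff complex_eq_iff)
  qed
  define dirichlet where "dirichlet j v v' \<longleftrightarrow>
      C2_decaying (\<lambda>x. of_real (v x)) (\<lambda>x. of_real (v' x)) (\<lambda>x. of_real (\<kappa>\<^sup>2 * (v x - Re (k j x)))) \<and> v 0 = 0 \<and>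
      (C = \<real>\<^sub>\<ge>\<^sub>0 \<longrightarrow> 0 \<le> v' 0 \<and> (\<forall>x\<ge>0. 0 \<le> v x))" for j and v v' :: "real \<Rightarrow> real"
  have "\<exists>v v'. dirichlet j v v'" for j
  proof -
    obtain R where R: "continuous_on {0..} (k j)" "\<And>x. R < x \<Longrightarrow> k j x = 0"
      using k[of j] by (auto simp: compactly_supported_in_def)
    have kj: "continuous_on {0..} (\<lambda>x. Re (k j x))" "\<And>x. R < x \<Longrightarrow> Re (k j x) = 0"
      using R by (auto intro!: continuous_intros)
    show ?thesis
      unfolding dirichlet_def by (rule dirichlet_resolvent[OF \<kappa> kj]) (use k_nonneg in blast)+
  qed
  then obtain v v' where vv': "\<And>j. dirichlet j (v j) (v' j)"
    by metis
  then have
    v: "\<And>j. C2_decaying (\<lambda>x. of_real (v j x)) (\<lambda>x. of_real (v' j x)) (\<lambda>x. of_real (\<kappa>\<^sup>2 * (v j x - Re (k j x))))"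
      "\<And>j. v j 0 = 0" and
    v_nonneg: "\<And>j. C = \<real>\<^sub>\<ge>\<^sub>0 \<Longrightarrow> 0 \<le> v' j 0" "\<And>j x. C = \<real>\<^sub>\<ge>\<^sub>0 \<Longrightarrow> 0 \<le> x \<Longrightarrow> 0 \<le> v j x"
    by (simp_all add: dirichlet_def)
  define g :: "complex^2" where "g = (\<chi> j. of_real (v' j 0 / (2 * \<kappa>)))"
  have g: "\<forall>i. g $ i \<in> C"
    using C v_nonneg(1) \<kappa> by (auto simp: g_def complex_nonneg_Reals_iff simp del: of_real_divide of_real_mult)
  define a where "a = g + ?S *v g"
  have a_in: "a $ i \<in> C" for i
    using S[OF g] by (simp add: a_def matrix_vector_mult_add_rdistrib)
  define u u' u'' where
    "u j x = of_real (v j x) + a $ j * of_real (exp (- \<kappa> * x))"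
    "u' j x = of_real (v' j x) + - \<kappa> * a $ j * of_real (exp (- \<kappa> * x))"
    "u'' j x = of_real (\<kappa>\<^sup>2 * (v j x - Re (k j x))) + \<kappa>\<^sup>2 * a $ j * of_real (exp (- \<kappa> * x))" for j x
  have u: "C2_decaying (u j) (u' j) (u'' j)" for j
    using C2_decaying_add[OF v(1)[of j] C2_decaying_exp[OF \<kappa>, of "a $ j"]]
    unfolding u_u'_u''_def by simp
  have u''_eq: "u'' j x = \<kappa>\<^sup>2 * (u j x - k j x)" for j x
    by (simp add: u_u'_u''_def k_real algebra_simps)
  have bc: "vector [u 1 0, u 2 0] = g + ?S *v g"
    unfolding a_def[symmetric] by (simp add: u_u'_u''_def v(2) vector2_eta)
  have "u' j 0 = (complex_of_real \<kappa> *s (g - ?S *v g)) $ j" for j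
  proof -
    have "complex_of_real (v' j 0) = 2 * \<kappa> * g $ j"
      using \<kappa> by (simp add: g_def)
    then have "u' j 0 = 2 * \<kappa> * g $ j - \<kappa> * a $ j"
      by (simp add: u_u'_u''_def)
    also have "\<dots> = \<kappa> * (g $ j - (?S *v g) $ j)"
      by (simp add: a_def algebra_simps)
    finally show ?thesis by (simp add: right_diff_distrib)
  qed
  then have bc': "vector [u' 1 0, u' 2 0] = complex_of_real \<kappa> *s (g - ?S *v g)"
    by (simp only: vector2_eta)
  have "((abs_L2h (u 1), abs_L2h (u 2)), (abs_L2h (u'' 1), abs_L2h (u'' 2))) \<in> laplacian A B"
    unfolding C2_decaying_laplacian[OF u u] bc bc'
    using boundary_condition_iff_cayley[OF inv, of g "?S *v g"] by simp
  moreover have "values_in C (abs_L2h (u j))" for j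
  proof -
    have "u j x \<in> C" if "0 \<le> x" for x
    proof -
      have "a $ j \<in> C" by (rule a_in)
      then show ?thesis
        using C v_nonneg(2)[OF _ that] unfolding u_u'_u''_def
        by (auto intro!: nonneg_Reals_add_I nonneg_Reals_mult_I)
    qed
    then show ?thesis
      using u[of j] unfolding C2_decaying_def
      by (subst values_in_abs_L2h) (auto simp: decaying_sq_integrable space_restrict_space intro!: AE_I2)
  qed
  moreover have "abs_L2h (u j) - (1 / \<kappa>\<^sup>2) *\<^sub>R abs_L2h (u'' j) = abs_L2h (k j)" for j
  proof -
    have "sq_integrable (u j)" "sq_integrable (u'' j)"
      using u[of j] by (auto simp: C2_decaying_def decaying_sq_integrable)
    then have "abs_L2h (u j) - (1 / \<kappa>\<^sup>2) *\<^sub>R abs_L2h (u'' j) = abs_L2h (\<lambda>x. u j x - (1 / \<kappa>\<^sup>2) *\<^sub>R u'' j x)"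
      by (simp add: abs_L2h_diff abs_L2h_scaleR sq_integrable_scaleR)
    also have "(\<lambda>x. u j x - (1 / \<kappa>\<^sup>2) *\<^sub>R u'' j x) = k j"
      using \<kappa> by (simp add: fun_eq_iff u''_eq scaleR_conv_of_real)
    finally show ?thesis .
  qed
  ultimately show ?thesis
    by (intro exI[of _ "(abs_L2h (u 1), abs_L2h (u 2))"] exI[of _ "(abs_L2h (u'' 1), abs_L2h (u'' 2))"]) simp
qed

section \<open>Semigroups preserving values in the real or the nonnegative numbers\<close>

lemma closed_convex_Reals_or_nonneg:
  assumes "C = \<real> \<or> C = \<real>\<^sub>\<ge>\<^sub>0"
  shows "closed C" "convex C" "(0::complex) \<in> C"
  using assms
  by (auto simp: closed_complex_Reals closed_nonneg_Reals_complex convex_def scaleR_conv_of_real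
      intro!: nonneg_Reals_add_I nonneg_Reals_mult_I simp: complex_nonneg_Reals_iff)

text \<open>Invariance passes from the resolvent at \<open>h = 1 / \<kappa>\<^sup>2\<close> to the semigroup; small \<open>h\<close> correspond to
  large \<open>\<kappa>\<close>, for which \<open>A - \<kappa> * B\<close> is invertible.\<close>

proposition semigroup_preserves_values:
  assumes regular: "regular_bc A B" and sg: "C0_semigroup T" and qc: "quasi_contractive T"
    and gen: "generator T = laplacian A B"
    and C: "C = \<real> \<or> C = \<real>\<^sub>\<ge>\<^sub>0"
    and S: "\<And>\<kappa> \<xi>. \<kappa>\<^sub>0 \<le> \<kappa> \<Longrightarrow> 0 < \<kappa> \<Longrightarrow> invertible (A - map_matrix ((*) (complex_of_real \<kappa>)) B) \<Longrightarrow>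
      (\<forall>i. \<xi> $ i \<in> C) \<Longrightarrow> (\<forall>i. ((mat 1 + cayley (\<i> * complex_of_real \<kappa>) A B) *v \<xi>) $ i \<in> C)"
    and \<psi>: "values_in C (fst \<psi>)" "values_in C (snd \<psi>)" and t: "0 \<le> t"
  shows "values_in C (fst (T t \<psi>)) \<and> values_in C (snd (T t \<psi>))"
proof -
  note C' = closed_convex_Reals_or_nonneg[OF C]
  obtain \<kappa>\<^sub>1 where \<kappa>\<^sub>1: "0 < \<kappa>\<^sub>1"
    "\<And>\<kappa>. \<kappa>\<^sub>1 \<le> \<kappa> \<Longrightarrow> invertible (A - map_matrix ((*) (complex_of_real \<kappa>)) B)"
    using regular_bc_eventually_invertible[OF regular] by metis
  define m where "m = max \<kappa>\<^sub>0 \<kappa>\<^sub>1"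
  have m: "0 < m" using \<kappa>\<^sub>1(1) by (simp add: m_def)
  let ?V = "{f. values_in C f}" and ?D = "{abs_L2h k |k. compactly_supported_in C k}"
  have "T t \<psi> \<in> ?V \<times> ?V"
  proof (rule semigroup_invariant_if_resolvent_invariant[OF sg qc])
    show "closure (Domain (generator T)) = UNIV"
      unfolding gen by (rule closure_domain_laplacian)
    show "closed (?V \<times> ?V)"
      using C' by (intro closed_Times closed_values_in)
    show "?V \<times> ?V \<noteq> {}" using \<psi> by auto
    show "?V \<times> ?V \<subseteq> closure (?D \<times> ?D)"
      unfolding closure_Times using values_in_subset_closure[OF C'] by blast
    show "\<forall>\<^sub>F h in at_right 0. \<forall>k\<in>?D \<times> ?D. \<exists>w\<in>?V \<times> ?V. \<exists>z. (w, z) \<in> generator T \<and> w - h *\<^sub>R z = k"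
    proof (rule eventually_at_rightI[of _ "1 / m\<^sup>2"])
      fix h assume h: "h \<in> {0<..<1 / m\<^sup>2}"
      define \<kappa> where "\<kappa> = 1 / sqrt h"
      have \<kappa>: "0 < \<kappa>" "1 / \<kappa>\<^sup>2 = h"
        using h by (auto simp: \<kappa>_def power_divide)
      have "m\<^sup>2 \<le> \<kappa>\<^sup>2"
        using h m by (simp add: \<kappa>_def power_divide field_simps)
      then have "m \<le> \<kappa>"
        by (rule power2_le_imp_le) (use \<kappa>(1) in simp)
      then have ge: "\<kappa>\<^sub>0 \<le> \<kappa>" "\<kappa>\<^sub>1 \<le> \<kappa>" by (auto simp: m_def)
      show "\<forall>k\<in>?D \<times> ?D. \<exists>w\<in>?V \<times> ?V. \<exists>z. (w, z) \<in> generator T \<and> w - h *\<^sub>R z = k"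
      proof clarify
        fix k1 k2 assume k: "compactly_supported_in C k1" "compactly_supported_in C k2"
        define k where "k j = (if j = (1::2) then k1 else k2)" for j
        have "compactly_supported_in C (k j)" for j
          using k by (simp add: k_def)
        moreover have "k 1 = k1" "k 2 = k2"
          by (simp_all add: k_def)
        moreover note laplacian_resolvent[OF \<kappa>(1) \<kappa>\<^sub>1(2)[OF ge(2)] C S[OF ge(1) \<kappa>(1) \<kappa>\<^sub>1(2)[OF ge(2)]], of k]
        ultimately obtain w \<eta> where "(w, \<eta>) \<in> laplacian A B" "values_in C (fst w)" "values_in C (snd w)"
            "w - (1 / \<kappa>\<^sup>2) *\<^sub>R \<eta> = (abs_L2h k1, abs_L2h k2)"
          by auto
        then show "\<exists>w\<in>?V \<times> ?V. \<exists>z. (w, z) \<in> generator T \<and> w - h *\<^sub>R z = (abs_L2h k1, abs_L2h k2)"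
          unfolding gen \<kappa>(2) by (intro bexI[of _ w] exI[of _ \<eta>]) (auto simp: mem_Times_iff)
      qed
    qed (use m in simp)
    show "\<psi> \<in> ?V \<times> ?V" using \<psi> by (simp add: mem_Times_iff)
  qed fact
  then show ?thesis by (simp add: mem_Times_iff)
qed

section \<open>Real parts\<close>

lemma sq_integrable_Re: "sq_integrable (\<lambda>x. complex_of_real (Re (u x)))" if "sq_integrable u"
proof (rule sq_integrable_bound[OF _ that])
  show "(\<lambda>x. complex_of_real (Re (u x))) \<in> borel_measurable half_line"
    using sq_integrable_borel[OF that] by measurable
qed (simp add: abs_Re_le_cmod)

lift_definition re_part :: "L2h \<Rightarrow> L2h" is "\<lambda>f x. complex_of_real (Re (f x))"
  unfolding ae_eq_def by (auto intro: sq_integrable_Re elim: eventually_mono)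

lemma re_part_abs_L2h:
  "sq_integrable u \<Longrightarrow> re_part (abs_L2h u) = abs_L2h (\<lambda>x. complex_of_real (Re (u x)))"
  by (simp add: re_part.abs_eq ae_eq_refl_iff)

lemma bounded_linear_re_part: "bounded_linear re_part"
proof (rule bounded_linear_intro[where K = 1])
  show "re_part (f + g) = re_part f + re_part g" for f g
    by transfer (auto simp: ae_eq_def intro!: sq_integrable_add sq_integrable_Re)
  show "re_part (r *\<^sub>R f) = r *\<^sub>R re_part f" for r f
    by transfer (auto simp: ae_eq_def scaleR_conv_of_real intro!: sq_integrable_mult sq_integrable_Re)
  show "norm (re_part f) \<le> norm f * 1" for f
  proof -
    obtain u where u: "sq_integrable u" "f = abs_L2h u" by (rule L2h_cases)
    then show ?thesis
      by (simp add: re_part_abs_L2h norm_abs_L2h_mono sq_integrable_Re abs_Re_le_cmod)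
  qed
qed

lemma real_valued_re_part: "real_valued (re_part f)"
  by transfer simp

lemma re_part_real: "real_valued f \<Longrightarrow> re_part f = f"
  by transfer (auto simp: ae_eq_def sq_integrable_Re elim: eventually_mono)

lemma re_part_imaginary: "real_valued f \<Longrightarrow> re_part (cscale \<i> f) = 0"
proof transfer
  fix f assume f: "ae_eq f f" "AE x in half_line. f x \<in> \<real>"
  have "sq_integrable (\<lambda>x. complex_of_real (Re (\<i> * f x)))"
    using f(1) by (intro sq_integrable_Re sq_integrable_mult) (simp add: ae_eq_def)
  moreover have "AE x in half_line. complex_of_real (Re (\<i> * f x)) = 0"
    using f(2) by eventually_elim (simp add: complex_is_Real_iff)
  ultimately show "ae_eq (\<lambda>x. complex_of_real (Re (\<i> * f x))) (\<lambda>x. 0)"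
    by (simp add: ae_eq_def sq_integrable_zero)
qed

lemma re_part_decomposition: "f = re_part f + cscale \<i> (re_part (cscale (- \<i>) f))"
proof transfer
  fix f assume "ae_eq f f"
  then have f: "sq_integrable f" by (simp add: ae_eq_def)
  have "sq_integrable (\<lambda>x. complex_of_real (Re (f x)) + \<i> * complex_of_real (Re (- \<i> * f x)))"
    using f by (intro sq_integrable_add sq_integrable_mult sq_integrable_Re)
  moreover have "f x = complex_of_real (Re (f x)) + \<i> * complex_of_real (Re (- \<i> * f x))" for x
    by (simp add: complex_eq_iff)
  ultimately show "ae_eq f (\<lambda>x. complex_of_real (Re (f x)) + \<i> * complex_of_real (Re (- \<i> * f x)))"
    using f by (simp add: ae_eq_def)
qed

definition re_state :: "state \<Rightarrow> state"
  where "re_state = map_prod re_part re_part"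

lemma bounded_linear_re_state: "bounded_linear re_state"
  unfolding re_state_def map_prod_def case_prod_unfold
  by (intro bounded_linear_Pair bounded_linear_compose[OF bounded_linear_re_part]
      bounded_linear_fst bounded_linear_snd)

text \<open>Decompose a state into real and imaginary parts; by complex linearity the semigroup acts on each
  of them separately, and both images are real.\<close>

lemma real_semigroup_commutes_re_state:
  assumes sg: "C0_semigroup T" and real: "real_semigroup T" and t: "0 \<le> t"
  shows "T t (re_state \<psi>) = re_state (T t \<psi>)"
proof -
  let ?i = "map_prod (cscale \<i>) (cscale \<i>)"
  define \<sigma> where "\<sigma> = re_state (map_prod (cscale (- \<i>)) (cscale (- \<i>)) \<psi>)"
  have re: "real_valued (fst (re_state \<phi>))" "real_valued (snd (re_state \<phi>))" for \<phi>
    by (simp_all add: re_state_def real_valued_re_part)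
  have real_values: "real_valued (fst (T t (re_state \<phi>))) \<and> real_valued (snd (T t (re_state \<phi>)))" for \<phi>
    using real t re[of \<phi>] unfolding real_semigroup_def by blast
  have "\<psi> = re_state \<psi> + ?i \<sigma>"
    by (simp add: re_state_def \<sigma>_def prod_eq_iff flip: re_part_decomposition)
  then have "T t \<psi> = T t (re_state \<psi>) + T t (?i \<sigma>)"
    by (metis blinfun.add_right)
  also have "T t (?i \<sigma>) = ?i (T t \<sigma>)"
    using sg t unfolding C0_semigroup_def by blast
  finally have "re_state (T t \<psi>) = re_state (T t (re_state \<psi>)) + re_state (?i (T t \<sigma>))"
    by (simp add: linear_add[OF bounded_linear.linear[OF bounded_linear_re_state]])
  also have "re_state (?i (T t \<sigma>)) = 0"
    using real_values unfolding \<sigma>_def by (simp add: re_state_def prod_eq_iff re_part_imaginary)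
  also have "re_state (T t (re_state \<psi>)) = T t (re_state \<psi>)"
    using real_values[of \<psi>] by (simp add: re_state_def prod_eq_iff re_part_real)
  finally show ?thesis by simp
qed

lemma real_semigroup_generator_re_state:
  assumes sg: "C0_semigroup T" and real: "real_semigroup T" and gen: "(\<psi>, \<eta>) \<in> generator T"
  shows "(re_state \<psi>, re_state \<eta>) \<in> generator T"
proof -
  note lin = bounded_linear.linear[OF bounded_linear_re_state]
  have "((\<lambda>h. re_state ((T h \<psi> - \<psi>) /\<^sub>R h)) \<longlongrightarrow> re_state \<eta>) (at_right 0)"
    using gen by (intro bounded_linear.tendsto[OF bounded_linear_re_state]) (simp add: generator_def)
  moreover have "\<forall>\<^sub>F h in at_right 0. re_state ((T h \<psi> - \<psi>) /\<^sub>R h) = (T h (re_state \<psi>) - re_state \<psi>) /\<^sub>R h"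
    using eventually_at_right_less[of 0]
    by eventually_elim (simp add: linear_cmul[OF lin] linear_diff[OF lin] real_semigroup_commutes_re_state[OF sg real])
  ultimately show ?thesis
    by (simp add: generator_def tendsto_cong)
qed

text \<open>The combination of \<open>exp (- x)\<close> and \<open>exp (- 2 * x)\<close> with value \<open>a\<close> and derivative \<open>b\<close> at zero. Its
  coefficients are real combinations of \<open>a\<close> and \<open>b\<close>, so taking the real part of the function amounts to taking
  the real parts of the traces.\<close>

definition exponential_with_traces :: "complex \<Rightarrow> complex \<Rightarrow> real \<Rightarrow> complex"
  where "exponential_with_traces a b x =
    (2 * a + b) * complex_of_real (exp (- 1 * x)) + (- a - b) * complex_of_real (exp (- 2 * x))"

lemma C2_decaying_exponential_with_traces:
  obtains u' u'' where "C2_decaying (exponential_with_traces a b) u' u''"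
    "exponential_with_traces a b 0 = a" "u' 0 = b"
proof -
  note C2 = C2_decaying_add[OF C2_decaying_exp[of 1 "2 * a + b"] C2_decaying_exp[of 2 "- a - b"]]
  have "C2_decaying (exponential_with_traces a b)
    (\<lambda>x. - complex_of_real 1 * (2 * a + b) * complex_of_real (exp (- 1 * x)) +
      - complex_of_real 2 * (- a - b) * complex_of_real (exp (- 2 * x)))
    (\<lambda>x. (complex_of_real 1)\<^sup>2 * (2 * a + b) * complex_of_real (exp (- 1 * x)) +
      (complex_of_real 2)\<^sup>2 * (- a - b) * complex_of_real (exp (- 2 * x)))"
    unfolding exponential_with_traces_def[abs_def] by (rule C2) simp_all
  then show thesis
    by (rule that) (simp_all add: exponential_with_traces_def algebra_simps)
qed

lemma re_part_exponential_with_traces: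
  "re_part (abs_L2h (exponential_with_traces a b)) =
    abs_L2h (exponential_with_traces (of_real (Re a)) (of_real (Re b)))"
proof -
  have "sq_integrable (exponential_with_traces a b)"
    by (rule C2_decaying_exponential_with_traces[of a b]) (simp add: C2_decaying_def decaying_sq_integrable)
  moreover have "complex_of_real (Re (exponential_with_traces a b x)) =
      exponential_with_traces (of_real (Re a)) (of_real (Re b)) x" for x
    by (simp add: exponential_with_traces_def complex_eq_iff)
  ultimately show ?thesis
    by (simp add: re_part_abs_L2h)
qed

definition re_vec :: "complex^2 \<Rightarrow> complex^2"
  where "re_vec x = (\<chi> i. complex_of_real (Re (x $ i)))"

text \<open>The generator of a real semigroup is compatible with real parts of states. Applied to explicit
  elements of its domain with given traces, this shows that the real part of a solution
  of the boundary condition is again a solution.\<close>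

lemma real_semigroup_boundary_condition:
  assumes sg: "C0_semigroup T" and real: "real_semigroup T" and gen: "generator T = laplacian A B"
    and bc: "A *v a + B *v b = 0"
  shows "A *v re_vec a + B *v re_vec b = 0"
proof -
  let ?u = exponential_with_traces
  have "\<exists>u' u''. C2_decaying (?u a b) u' u'' \<and> ?u a b 0 = a \<and> u' 0 = b" for a b
    using C2_decaying_exponential_with_traces by metis
  then obtain u' u'' where u: "\<And>a b. C2_decaying (?u a b) (u' a b) (u'' a b)"
      "\<And>a b. ?u a b 0 = a" "\<And>a b. u' a b 0 = b"
    by metis
  have "((abs_L2h (?u (a $ 1) (b $ 1)), abs_L2h (?u (a $ 2) (b $ 2))),
      (abs_L2h (u'' (a $ 1) (b $ 1)), abs_L2h (u'' (a $ 2) (b $ 2)))) \<in> generator T"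
    unfolding gen C2_decaying_laplacian[OF u(1) u(1)] by (simp add: u(2,3) vector2_eta bc)
  from real_semigroup_generator_re_state[OF sg real this] obtain \<eta> where
    "((abs_L2h (?u (re_vec a $ 1) (re_vec b $ 1)), abs_L2h (?u (re_vec a $ 2) (re_vec b $ 2))), \<eta>) \<in> laplacian A B"
    unfolding gen by (simp add: re_state_def re_part_exponential_with_traces re_vec_def)
  then show ?thesis
    unfolding C2_decaying_laplacian[OF u(1) u(1)] by (simp add: u(2,3) vector2_eta)
qed

text \<open>For a basis vector \<open>e\<close>, the traces parametrised by \<open>e\<close> and \<open>S e\<close> satisfy the boundary condition, hence
  so do their real parts, which are parametrised by \<open>e\<close> and the real part of \<open>S e\<close>. As \<open>e\<close> determines its partner,
  \<open>S e\<close> is real.\<close>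

lemma real_semigroup_cayley_real:
  assumes sg: "C0_semigroup T" and real: "real_semigroup T" and gen: "generator T = laplacian A B"
    and inv: "invertible (A - map_matrix ((*) (complex_of_real \<kappa>)) B)"
  shows "real_entries (cayley (\<i> * complex_of_real \<kappa>) A B)"
  unfolding real_entries_def
proof (intro allI)
  fix i j :: 2
  let ?S = "cayley (\<i> * complex_of_real \<kappa>) A B"
  define e :: "complex^2" where "e = axis j 1"
  have e: "re_vec e = e"
    by (simp add: e_def re_vec_def axis_def vec_eq_iff)
  have "A *v (e + ?S *v e) + B *v (complex_of_real \<kappa> *s (e - ?S *v e)) = 0"
    using boundary_condition_iff_cayley[OF inv, of e "?S *v e"] by simp
  from real_semigroup_boundary_condition[OF sg real gen this]
  have "A *v (re_vec e + re_vec (?S *v e)) + B *v (complex_of_real \<kappa> *s (re_vec e - re_vec (?S *v e))) = 0"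
    by (simp add: re_vec_def plus_vec_def minus_vec_def vector_scalar_mult_def)
  then have "re_vec (?S *v e) = ?S *v e"
    unfolding e using boundary_condition_iff_cayley[OF inv] by blast
  then have "complex_of_real (Re ((?S *v e) $ i)) = (?S *v e) $ i"
    by (metis re_vec_def vec_lambda_beta)
  moreover have "(?S *v e) $ i = ?S $ i $ j"
    by (simp add: e_def matrix_vector_mult_def axis_def if_distrib[of "(*) _"] cong: if_cong)
  ultimately show "?S $ i $ j \<in> \<real>"
    by (metis Reals_of_real)
qed

theorem corollary6p3:
  fixes A B :: "complex^2^2" and T :: "real \<Rightarrow> (L2h \<times> L2h) \<Rightarrow>\<^sub>L (L2h \<times> L2h)"
  assumes regular: "regular_bc A B"
    and semigroup: "C0_semigroup T"
    and quasi_contractive: "quasi_contractive T"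
    and generated: "generator T = laplacian A B"
  shows "(real_semigroup T \<longleftrightarrow>
      (\<forall>\<kappa>::real. \<kappa> > 0 \<and> invertible (A - map_matrix ((*) (complex_of_real \<kappa>)) B) \<longrightarrow>
        real_entries (cayley (\<i> * complex_of_real \<kappa>) A B)))
    \<and> (real_semigroup T \<longrightarrow>
      (\<exists>\<kappa>0::real. \<kappa>0 > 0 \<and> (\<forall>\<kappa>\<ge>\<kappa>0.
        invertible (A - map_matrix ((*) (complex_of_real \<kappa>)) B) \<longrightarrow>
        leaves_quadrant_invariant (mat 1 + cayley (\<i> * complex_of_real \<kappa>) A B))) \<longrightarrow>
      positive_semigroup T)"
proof (intro conjI iffI impI allI)
  fix \<kappa> :: real
  assume "real_semigroup T" "\<kappa> > 0 \<and> invertible (A - map_matrix ((*) (complex_of_real \<kappa>)) B)"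
  then show "real_entries (cayley (\<i> * complex_of_real \<kappa>) A B)"
    using real_semigroup_cayley_real[OF semigroup _ generated] by blast
next
  assume real: "\<forall>\<kappa>::real. \<kappa> > 0 \<and> invertible (A - map_matrix ((*) (complex_of_real \<kappa>)) B) \<longrightarrow>
        real_entries (cayley (\<i> * complex_of_real \<kappa>) A B)"
  have "(\<forall>i. ((mat 1 + cayley (\<i> * complex_of_real \<kappa>) A B) *v \<xi>) $ i \<in> \<real>)"
    if "0 < \<kappa>" "invertible (A - map_matrix ((*) (complex_of_real \<kappa>)) B)" "\<forall>i. \<xi> $ i \<in> \<real>" for \<kappa> \<xi>
    using that real by (auto simp: real_entries_def matrix_vector_mult_add_rdistrib matrix_vector_mult_def[of "cayley _ _ _"]
        intro!: Reals_add sum_in_Reals Reals_mult)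
  then show "real_semigroup T"
    unfolding real_semigroup_def real_valued_eq_values_in
    using semigroup_preserves_values[OF regular semigroup quasi_contractive generated, of \<real> 0] by blast
next
  assume "\<exists>\<kappa>0::real. \<kappa>0 > 0 \<and> (\<forall>\<kappa>\<ge>\<kappa>0. invertible (A - map_matrix ((*) (complex_of_real \<kappa>)) B) \<longrightarrow>
        leaves_quadrant_invariant (mat 1 + cayley (\<i> * complex_of_real \<kappa>) A B))"
  then obtain \<kappa>0 where "\<And>\<kappa> \<xi>. \<kappa>0 \<le> \<kappa> \<Longrightarrow> invertible (A - map_matrix ((*) (complex_of_real \<kappa>)) B) \<Longrightarrow>
      (\<forall>i. \<xi> $ i \<in> \<real>\<^sub>\<ge>\<^sub>0) \<Longrightarrow> (\<forall>i. ((mat 1 + cayley (\<i> * complex_of_real \<kappa>) A B) *v \<xi>) $ i \<in> \<real>\<^sub>\<ge>\<^sub>0)"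
    unfolding leaves_quadrant_invariant_def by blast
  then show "positive_semigroup T"
    unfolding positive_semigroup_def nonneg_valued_eq_values_in
    using semigroup_preserves_values[OF regular semigroup quasi_contractive generated, of "\<real>\<^sub>\<ge>\<^sub>0" \<kappa>0] by blast
qed

end
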